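(* Let $\gamma=(\gamma_q)_{q\geq 1}$ be a sequence of real numbers and let $\psi:\mathbb{N}\to\mathbb{R}_{\geq 0}$ be decreasing. Suppose there exist $\varepsilon>0$ and an integer $k\geq 2$ for which $$\sum_{q=1}^\infty \frac{\psi(q)}{\sqrt{\log q}\,\Big(\prod_{j=2}^{k-1}\log^{(j)} q\Big)\,\big(\log^{(k)} q\big)^{1+\varepsilon}}=\infty .$$ Then $\mathrm{m}(W(\psi,\gamma))=1$. In particular, if $\sum_{q=1}^\infty \psi(q)(\log q)^{-\frac12-\varepsilon}=\infty$ for some $\varepsilon>0$, then $\mathrm{m}(W(\psi,\gamma))=1$.
   Context: $\mathbb{N}=\{1,2,3,\dots\}$. "Decreasing" means $\psi(q+1)\leq\psi(q)$ for all $q$. $\|x\|$ denotes the distance from $x\in\mathbb{R}$ to the nearest integer, and $\mathrm{m}$ is Lebesgue measure. For a sequence $\gamma=(\gamma_q)_{q\ge1}$ of real numbers and $\psi:\mathbb{N}\to\mathbb{R}_{\geq 0}$, $$W(\psi,\gamma)=\{\alpha\in[0,1] : \|q\alpha-\gamma_q\|<\psi(q)\text{ for infinitely many } q\in\mathbb{N}\}.$$ Throughout, $\log x$ means $\max\{1,\ln x\}$, where $\ln$ is the natural logarithm, and $\log^{(j)}$ denotes the $j$-fold iterate of this function $\log$ (so $\log^{(2)}q=\log\log q$, etc.). An empty product equals $1$; thus for $k=2$ the denominator is $\sqrt{\log q}\,(\log\log q)^{1+\varepsilon}$. *)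

theory Defs
  imports "HOL-Analysis.Analysis"
begin

text \<open>
  The positive integers are modelled by \<^typ>\<open>nat\<close> with an explicit guard
  \<open>1 \<le> q\<close>; the values of sequences at \<open>0\<close> are never used.
\<close>

definition int_dist :: "real \<Rightarrow> real" where
  "int_dist x = infdist x \<int>"

definition W :: "(nat \<Rightarrow> real) \<Rightarrow> (nat \<Rightarrow> real) \<Rightarrow> real set" where
  "W \<psi> \<gamma> = {\<alpha> \<in> {0..1}. infinite {q. 1 \<le> q \<and> int_dist (real q * \<alpha> - \<gamma> q) < \<psi> q}}"

definition Log :: "real \<Rightarrow> real" where
  "Log x = max 1 (ln x)"

text \<open>The truncation is applied at every step of the iteration, so that all iterates are at least 1.\<close>

definition iter_Log :: "nat \<Rightarrow> real \<Rightarrow> real" where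
  "iter_Log j x = (Log ^^ j) x"

definition series_diverges :: "(nat \<Rightarrow> real) \<Rightarrow> bool" where
  "series_diverges f \<longleftrightarrow> filterlim (\<lambda>N. \<Sum>q=1..N. f q) at_top sequentially"

end

theory Submission
  imports Defs "HOL-Number_Theory.Prime_Powers"
begin

text \<open>
  Averaging over the translations by \<open>j / r\<close> shows that the sets
  \<open>A q = {\<alpha>. int_dist (q * \<alpha> - \<gamma> q) < \<phi> q}\<close> satisfy
  \<open>m (A q \<inter> A r) \<le> m (A q) * m (A r) + 2 * \<phi> r * gcd q r / r\<close> for \<open>q \<le> r\<close>, whatever
  \<open>\<gamma>\<close> is. Over all integers the sum of the error terms exceeds the first moment by a logarithm.
  Within a block \<open>2 ^ 4 ^ n \<le> q < 2 ^ 4 ^ Suc n\<close> we therefore keep only those \<open>q\<close> all of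
  whose prime factors exceed \<open>y = 2 ^ 2 ^ n\<close>. They have density of order
  \<open>1 / ln y\<close>, i.e. \<open>1 / sqrt (ln q)\<close>, and have so few divisors that the error terms sum to
  no more than a constant times the first moment. Chebyshev's inequality then bounds the set
  missed by the whole block by a constant over the first moment. Finally, divergence of the series
  makes the first moments of the blocks unbounded, because the remaining factors of the weight,
  taken at \<open>q = 2 ^ 4 ^ n\<close>, form a convergent Bertrand series in \<open>n\<close>.
\<close>

subsection \<open>Chebyshev bounds\<close>

text \<open>The square root comes from a balance. Up to the factor \<open>1 / ln y\<close>, the
  error terms beyond the first moment are governed by the number of divisors of rough
  \<open>r \<le> R\<close>, that is, of pairs of rough numbers with product at most
  \<open>R\<close>, which is of order \<open>R * ln R / (ln y)\<^sup>2\<close>. This is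
  \<open>O(R)\<close> as soon as \<open>ln y\<close> is at least of order
  \<open>sqrt (ln R)\<close>, and a larger \<open>y\<close> only lowers the density. Inside a block
  \<open>ln q\<close> varies by a factor 4 at most, so one \<open>y\<close> is near the optimum
  throughout; and only about \<open>ln (ln q)\<close> blocks lie below \<open>q\<close>, which is
  why the rest of the weight starts with the second iterated logarithm.

  Monotonicity of \<open>\<psi>\<close> enters through partial summation, which turns densities of
  rough numbers into weighted sums. The densities come from Chebyshev's method: logarithms of rough
  numbers are convolutions of \<open>mangoldt\<close> with 1, and unique factorization into a smooth
  and a rough part controls the sums of reciprocals.\<close>

lemma sum_divisors_eq:
  fixes F :: "nat \<Rightarrow> nat \<Rightarrow> real"
  shows "(\<Sum>n=1..x. \<Sum>d | d dvd n. F d (n div d)) = (\<Sum>d=1..x. \<Sum>m=1..x div d. F d m)"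
proof -
  have "(\<Sum>n=1..x. \<Sum>d | d dvd n. F d (n div d))
      = (\<Sum>(n, d)\<in>Sigma {1..x} (\<lambda>n. {d. d dvd n}). F d (n div d))"
    by (rule sum.Sigma) auto
  \<comment> \<open>Both sides index the pairs with \<open>d * m \<le> x\<close>. This exchange
    serves sums of logarithms and divisor counts alike.\<close>
  also have "\<dots> = (\<Sum>(d, m)\<in>Sigma {1..x} (\<lambda>d. {1..x div d}). F d m)"
  proof (rule sum.reindex_bij_witness[where i = "\<lambda>(d, m). (d * m, d)" and j = "\<lambda>(n, d). (d, n div d)"])
    fix a :: "nat \<times> nat" assume "a \<in> Sigma {1..x} (\<lambda>n. {d. d dvd n})"
    then obtain n d where a: "a = (n, d)" "1 \<le> n" "n \<le> x" "d dvd n" by auto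
    then have d: "d > 0" "d \<le> n" by (auto intro: Nat.gr0I dvd_imp_le)
    have "0 < n div d" using d by (simp add: div_greater_zero_iff)
    moreover have "n div d \<le> x div d" using a by (intro div_le_mono)
    ultimately show "(case a of (n, d) \<Rightarrow> (d, n div d)) \<in> Sigma {1..x} (\<lambda>d. {1..x div d})"
      using a d by auto
  next
    fix b :: "nat \<times> nat" assume "b \<in> Sigma {1..x} (\<lambda>d. {1..x div d})"
    then obtain d m where b: "b = (d, m)" "1 \<le> d" "d \<le> x" "1 \<le> m" "m \<le> x div d" by auto
    have "d * m \<le> d * (x div d)" using b by simp
    also have "\<dots> \<le> x" by simp
    finally show "(case b of (d, m) \<Rightarrow> (d * m, d)) \<in> Sigma {1..x} (\<lambda>n. {d. d dvd n})"
      using b by auto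
  qed auto
  also have "\<dots> = (\<Sum>d=1..x. \<Sum>m=1..x div d. F d m)"
    by (rule sum.Sigma[symmetric]) auto
  finally show ?thesis .
qed

lemma mangoldt_sum_nonzero:
  assumes "n > 0"
  shows "(\<Sum>d | d dvd n. mangoldt d) = ln (real n)"
  using mangoldt_sum[of n, where ?'a = real] assms by simp

text \<open>This is Chebyshev's function psi; the letter is left to the approximating
  function.\<close>

definition chebyshev :: "nat \<Rightarrow> real" where
  "chebyshev n = (\<Sum>d=1..n. mangoldt d)"

lemma chebyshev_mono: "m \<le> n \<Longrightarrow> chebyshev m \<le> chebyshev n"
  unfolding chebyshev_def by (intro sum_mono2 mangoldt_nonneg) auto

lemma ln_fact_eq:
  "ln (fact n :: real) = (\<Sum>d=1..n. mangoldt d * real (n div d))"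
proof -
  have "ln (fact n :: real) = (\<Sum>k=1..n. ln (real k))"
  proof (induction n)
    case (Suc n)
    have "ln (fact (Suc n) :: real) = ln (real (Suc n)) + ln (fact n)"
      unfolding fact_Suc by (subst ln_mult_pos) auto
    then show ?case using Suc by simp
  qed simp
  also have "\<dots> = (\<Sum>k=1..n. \<Sum>d | d dvd k. mangoldt d)"
    by (intro sum.cong refl) (simp add: mangoldt_sum_nonzero)
  also have "\<dots> = (\<Sum>d=1..n. \<Sum>m=1..n div d. mangoldt d)"
    using sum_divisors_eq[of "\<lambda>d m. mangoldt d" n] .
  also have "\<dots> = (\<Sum>d=1..n. mangoldt d * real (n div d))"
    by (simp add: mult.commute)
  finally show ?thesis .
qed

text \<open>The coefficient of \<open>mangoldt d\<close> is always 0 or 1, and it is 1 for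
  \<open>n < d \<le> 2 * n\<close>; the identity therefore yields bounds for
  \<open>chebyshev\<close> from both sides.\<close>

lemma ln_central_binomial:
  "ln (real ((2 * n) choose n))
     = (\<Sum>d=1..2*n. mangoldt d * (real ((2 * n) div d) - 2 * real (n div d)))"
proof -
  have "real ((2 * n) choose n) = fact (2 * n) / (fact n * fact n)"
    by (simp add: binomial_fact)
  then have "ln (real ((2 * n) choose n)) = ln (fact (2 * n)) - 2 * ln (fact n)"
    by (simp add: ln_div ln_mult)
  also have "ln (fact n :: real) = (\<Sum>d=1..2*n. mangoldt d * real (n div d))"
    unfolding ln_fact_eq by (rule sum.mono_neutral_left) auto
  also have "ln (fact (2 * n)) - 2 * (\<Sum>d=1..2*n. mangoldt d * real (n div d))
     = (\<Sum>d=1..2*n. mangoldt d * (real ((2 * n) div d) - 2 * real (n div d)))"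
    unfolding ln_fact_eq by (simp add: sum_subtractf sum_distrib_left algebra_simps)
  finally show ?thesis .
qed

lemma chebyshev_double_upper: "chebyshev (2 * n) - chebyshev n \<le> 2 * real n * ln 2"
proof -
  have "chebyshev (2 * n) - chebyshev n = (\<Sum>d\<in>{n+1..2*n}. mangoldt d)"
  proof -
    have "{1..2*n} = {1..n} \<union> {n+1..2*n}" by auto
    then show ?thesis unfolding chebyshev_def by (simp add: sum.union_disjoint)
  qed
  also have "\<dots> = (\<Sum>d\<in>{n+1..2*n}. mangoldt d * (real ((2 * n) div d) - 2 * real (n div d)))"
  proof (intro sum.cong refl)
    fix d assume "d \<in> {n+1..2*n}"
    then have "n div d = 0" "(2 * n) div d = 1"
      by (auto intro!: div_nat_eqI)
    then show "mangoldt d = mangoldt d * (real ((2 * n) div d) - 2 * real (n div d))" by simp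
  qed
  also have "\<dots> \<le> (\<Sum>d=1..2*n. mangoldt d * (real ((2 * n) div d) - 2 * real (n div d)))"
  proof (intro sum_mono2)
    fix d
    have "2 * (n div d) \<le> (2 * n) div d"
      using div_mult2_eq[of "2*n" 1 d] by (metis div_add1_eq le_add1 mult_2)
    then have "0 \<le> real ((2 * n) div d) - 2 * real (n div d)" by linarith
    then show "0 \<le> mangoldt d * (real ((2 * n) div d) - 2 * real (n div d))"
      by (simp add: mangoldt_nonneg)
  qed auto
  also have "\<dots> = ln (real ((2 * n) choose n))" by (simp add: ln_central_binomial)
  also have "\<dots> \<le> ln (2 ^ (2 * n))"
  proof -
    have "(2 * n) choose n \<le> 2 ^ (2 * n)" by (rule binomial_le_pow2)
    then have "real ((2 * n) choose n) \<le> 2 ^ (2 * n)" by (metis of_nat_le_iff of_nat_numeral of_nat_power)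
    moreover have "0 < real ((2 * n) choose n)" by simp
    ultimately show ?thesis by (intro ln_mono) auto
  qed
  also have "\<dots> = 2 * real n * ln 2" by (simp add: ln_realpow)
  finally show ?thesis .
qed

lemma chebyshev_double_lower:
  assumes "n > 0" shows "real n * ln 4 - ln (2 * real n) \<le> chebyshev (2 * n)"
proof -
  have "real n * ln 4 - ln (2 * real n) = ln (4 ^ n / (2 * real n))"
    using assms by (simp add: ln_div ln_realpow)
  also have "\<dots> \<le> ln (real ((2 * n) choose n))"
    using assms central_binomial_lower_bound[of n] by (intro ln_mono) auto
  also have "\<dots> = (\<Sum>d=1..2*n. mangoldt d * (real ((2 * n) div d) - 2 * real (n div d)))"
    by (rule ln_central_binomial)
  also have "\<dots> \<le> (\<Sum>d=1..2*n. mangoldt d * 1)"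
  proof (intro sum_mono mult_left_mono mangoldt_nonneg)
    fix d assume "d \<in> {1..2*n}"
    then have "d > 0" by simp
    have "2 * n < d * (2 * (n div d) + 2)"
      using dividend_less_times_div[OF \<open>d > 0\<close>, of n] by (simp add: algebra_simps)
    then have "(2 * n) div d < 2 * (n div d) + 2"
      by (simp add: less_mult_imp_div_less mult.commute)
    then show "real ((2 * n) div d) - 2 * real (n div d) \<le> 1" by linarith
  qed
  finally show ?thesis by (simp add: chebyshev_def)
qed

lemma chebyshev_pow2_le: "chebyshev (2 ^ k) \<le> 2 * 2 ^ k * ln 2"
proof (induction k)
  case (Suc k)
  have "chebyshev (2 * 2 ^ k) \<le> 2 * real (2 ^ k) * ln 2 + 2 * 2 ^ k * ln 2"
    using chebyshev_double_upper[of "2 ^ k"] Suc by linarith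
  then show ?case by (simp add: algebra_simps)
qed (simp add: chebyshev_def)

text \<open>One factor 2 is the geometric series of the doubling bounds, the other is the cost of
  rounding \<open>n\<close> up to a power of two.\<close>

lemma chebyshev_le: "chebyshev n \<le> 4 * real n"
proof (cases "n = 0")
  case False
  obtain k where k: "2 ^ k \<le> n" "n < 2 ^ Suc k"
    using False ex_power_ivl1[of 2 n] by auto
  have "chebyshev n \<le> chebyshev (2 ^ Suc k)" using k by (intro chebyshev_mono) simp
  also have "\<dots> \<le> 4 * 2 ^ k * ln 2" using chebyshev_pow2_le[of "Suc k"] by simp
  also have "\<dots> \<le> 4 * 2 ^ k * 1" using ln_2_less_1 by (intro mult_left_mono) auto
  also have "\<dots> \<le> 4 * real n"
    using k(1) by simp
  finally show ?thesis .
qed (simp add: chebyshev_def)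

lemma chebyshev_ge:
  assumes "100 \<le> n" shows "real n / 2 \<le> chebyshev n"
proof -
  define m where "m = n div 2"
  have m: "m \<ge> 50" "real n \<le> 2 * real m + 1" "2 * m \<le> n"
    using assms unfolding m_def by linarith+
  have "real m * ln 4 - ln (2 * real m) \<le> chebyshev (2 * m)"
    using m by (intro chebyshev_double_lower) auto
  also have "\<dots> \<le> chebyshev n" using m by (intro chebyshev_mono) auto
  finally have 1: "real m * ln 4 - ln (2 * real m) \<le> chebyshev n" .
  have ln4: "ln (4::real) \<ge> 4/3"
    using ln2_ge_two_thirds ln_realpow[of 2 2] by simp
  \<comment> \<open>Splitting off 16 before applying \<open>ln t \<le> t - 1\<close> reduces the
    slope in \<open>m\<close> to 1/8, which the main term \<open>m * ln 4\<close> can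
    afford.\<close>
  have "ln (2 * real m) = ln (4 * (4 * (real m / 8)))" by simp
  also have "\<dots> = ln 4 + (ln 4 + ln (real m / 8))"
    using m by (simp only: ln_mult_pos)
  also have "ln (real m / 8) \<le> real m / 8 - 1" using m by (intro ln_le_minus_one) auto
  finally have 2: "ln (2 * real m) \<le> 2 * ln 4 + real m / 8 - 1" by simp
  have "(real m - 2) * (4/3) \<le> (real m - 2) * ln 4" using ln4 m by (intro mult_left_mono) auto
  then show ?thesis using 1 2 m unfolding left_diff_distrib by linarith
qed

text \<open>The upper half of Mertens' first theorem: \<open>ln (fact n)\<close> is at most
  \<open>n * ln n\<close>, and replacing \<open>n div d\<close> by \<open>n / d\<close> in its
  expansion costs \<open>chebyshev n \<le> 4 * n\<close>.\<close>

lemma mangoldt_div_sum_le: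
  assumes "n > 0" shows "(\<Sum>d=1..n. mangoldt d / real d) \<le> ln (real n) + 4"
proof -
  have "real n * (\<Sum>d=1..n. mangoldt d / real d) = (\<Sum>d=1..n. mangoldt d * (real n / real d))"
    by (simp add: sum_distrib_left mult.commute)
  also have "\<dots> \<le> (\<Sum>d=1..n. mangoldt d * (real (n div d) + 1))"
  proof (intro sum_mono mult_left_mono mangoldt_nonneg)
    fix d assume "d \<in> {1..n}"
    then have "d > 0" by simp
    have "n \<le> d * (n div d + 1)" using dividend_less_times_div[OF \<open>d > 0\<close>, of n] by simp
    then have "real n \<le> real d * (real (n div d) + 1)"
      by (metis of_nat_1 of_nat_add of_nat_le_iff of_nat_mult)
    then show "real n / real d \<le> real (n div d) + 1" using \<open>d > 0\<close> by (simp add: field_simps)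
  qed
  also have "\<dots> = ln (fact n) + chebyshev n"
    by (simp add: ln_fact_eq chebyshev_def algebra_simps sum.distrib)
  also have "ln (fact n :: real) \<le> ln (real n ^ n)"
  proof -
    have "(fact n :: real) \<le> real n ^ n" using fact_le_power[of n, where ?'a = real] by simp
    then show ?thesis by (intro ln_mono) auto
  qed
  also have "ln (real n ^ n) = real n * ln (real n)" using assms by (simp add: ln_realpow)
  finally have "real n * (\<Sum>d=1..n. mangoldt d / real d) \<le> real n * (ln (real n) + 4)"
    using chebyshev_le[of n] by (simp add: algebra_simps)
  then show ?thesis using assms by simp
qed

subsection \<open>Rough and smooth numbers\<close>

text \<open>The thresholds \<open>y < p\<close> here and \<open>p \<le> y\<close> for smooth numbers
  are complementary, so every positive number splits uniquely. The number 1 is rough and has to be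
  removed by hand later on.\<close>

definition rough :: "nat \<Rightarrow> nat \<Rightarrow> bool" where
  "rough y n \<longleftrightarrow> 0 < n \<and> (\<forall>p. prime p \<longrightarrow> p dvd n \<longrightarrow> y < p)"

definition smooth :: "nat \<Rightarrow> nat \<Rightarrow> bool" where
  "smooth y n \<longleftrightarrow> 0 < n \<and> (\<forall>p. prime p \<longrightarrow> p dvd n \<longrightarrow> p \<le> y)"

lemma rough_mult_iff: "rough y (a * b) \<longleftrightarrow> rough y a \<and> rough y b"
  by (auto simp: rough_def prime_dvd_mult_iff)

lemma smooth_mult_iff: "smooth y (a * b) \<longleftrightarrow> smooth y a \<and> smooth y b"
  by (auto simp: smooth_def prime_dvd_mult_iff)

lemma rough_1 [simp]: "rough y (Suc 0)" and smooth_1 [simp]: "smooth y (Suc 0)"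
  by (auto simp: rough_def smooth_def)

lemma rough_pos: "rough y n \<Longrightarrow> 0 < n" and smooth_pos: "smooth y n \<Longrightarrow> 0 < n"
  by (auto simp: rough_def smooth_def)

lemma smooth_le: "0 < n \<Longrightarrow> n \<le> y \<Longrightarrow> smooth y n"
  by (metis smooth_def dvd_imp_le order_trans)

lemma rough_gt:
  assumes "rough y n" "n \<noteq> 1" shows "y < n"
proof -
  obtain p where p: "prime p" "p dvd n" using assms(2) prime_factor_nat by blast
  then have "y < p" "p \<le> n" using assms(1) by (auto simp: rough_def intro: dvd_imp_le)
  then show ?thesis by simp
qed

lemma coprime_smooth_rough:
  assumes "smooth y a" "rough y b" shows "coprime a b"
  unfolding coprime_iff_gcd_eq_1
proof (rule ccontr)
  assume "gcd a b \<noteq> 1"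
  then obtain p where "prime p" "p dvd gcd a b" using prime_factor_nat by blast
  then have "p \<le> y" "y < p" using assms by (auto simp: smooth_def rough_def)
  then show False by simp
qed

lemma smooth_rough_unique:
  assumes "smooth y a" "smooth y a'" "rough y b" "rough y b'" "a * b = a' * b'"
  shows "a = a' \<and> b = b'"
proof -
  have "a dvd a' * b'" "a' dvd a * b" using assms(5) by (metis dvd_triv_left)+
  then have "a dvd a'" "a' dvd a"
    using coprime_smooth_rough[OF assms(1,4)] coprime_smooth_rough[OF assms(2,3)]
    by (simp_all add: coprime_dvd_mult_left_iff)
  then have "a = a'" by (rule dvd_antisym)
  then show ?thesis using assms(5) smooth_pos[OF assms(1)] by simp
qed

text \<open>Injectivity turns the product of a sum over smooth and a sum over rough numbers into a
  sum over distinct integers.\<close>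

lemma inj_on_smooth_rough:
  assumes "A \<subseteq> {a. smooth y a}" "B \<subseteq> {b. rough y b}"
  shows "inj_on (\<lambda>(a, b). a * b) (A \<times> B)"
proof (rule inj_onI)
  fix u v assume uv: "u \<in> A \<times> B" "v \<in> A \<times> B"
    and eq: "(case u of (a, b) \<Rightarrow> a * b) = (case v of (a, b) \<Rightarrow> a * b)"
  obtain a b a' b' where [simp]: "u = (a, b)" "v = (a', b')" by fastforce
  have "smooth y a" "smooth y a'" "rough y b" "rough y b'" using uv assms by auto
  from smooth_rough_unique[OF this] eq show "u = v" by simp
qed

lemma smooth_rough_decomposition:
  "0 < n \<Longrightarrow> \<exists>a b. n = a * b \<and> smooth y a \<and> rough y b"
proof (induction n rule: less_induct)
  case (less n)
  show ?case
  proof (cases "n = 1")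
    case True
    then show ?thesis by (intro exI[of _ "1::nat"]) auto
  next
    case False
    then obtain p where p: "prime p" "p dvd n" using prime_factor_nat by blast
    then obtain m where m: "n = p * m" by (auto elim: dvdE)
    have "m < n" "0 < m" using less.prems p m prime_gt_1_nat[OF p(1)] by auto
    then obtain a b where ab: "m = a * b" "smooth y a" "rough y b" using less.IH by blast
    show ?thesis
    proof (cases "p \<le> y")
      case True
      then have "smooth y p"
        using p(1) primes_dvd_imp_eq[of _ p] by (auto simp: smooth_def prime_gt_0_nat)
      then have "smooth y (p * a)" using ab by (simp add: smooth_mult_iff)
      then show ?thesis using ab m by (metis mult.assoc)
    next
      case False
      have "rough y p"
        unfolding rough_def
      proof (intro conjI allI impI)
        fix q :: nat assume "prime q" "q dvd p"
        then have "q = p" using p(1) by (simp add: primes_dvd_imp_eq)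
        then show "y < q" using False by simp
      qed (rule prime_gt_0_nat[OF p(1)])
      then have "rough y (p * b)" using ab by (simp add: rough_mult_iff)
      then show ?thesis using ab m by (metis mult.left_commute)
    qed
  qed
qed

lemma sum_inverse_bounds:
  "ln (real n + 1) \<le> (\<Sum>k=1..n. 1 / real k)" "0 < n \<Longrightarrow> (\<Sum>k=1..n. 1 / real k) \<le> 1 + ln (real n)"
proof -
  have h: "harm n = (\<Sum>k=1..n. 1 / real k)" by (simp add: harm_def divide_inverse)
  show "ln (real n + 1) \<le> (\<Sum>k=1..n. 1 / real k)" using ln_le_harm[of n] h by simp
  assume "0 < n"
  then have "harm n - ln (real n) \<le> harm 1 - ln (real 1)"
  proof -
    from \<open>0 < n\<close> obtain m where "n = Suc m" by (cases n) auto
    then show ?thesis using decseqD[OF decseq_harm_diff_ln, of 0 m] by simp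
  qed
  then show "(\<Sum>k=1..n. 1 / real k) \<le> 1 + ln (real n)" using h by (simp add: harm_expand)
qed

section \<open>Counts and reciprocal sums of rough and smooth numbers\<close>

definition rough_count :: "nat \<Rightarrow> nat \<Rightarrow> real" where
  "rough_count y x = (\<Sum>b | b \<in> {1..x} \<and> rough y b. 1)"

definition rough_harm :: "nat \<Rightarrow> nat \<Rightarrow> real" where
  "rough_harm y x = (\<Sum>b | b \<in> {1..x} \<and> rough y b. 1 / real b)"

definition smooth_harm :: "nat \<Rightarrow> nat \<Rightarrow> real" where
  "smooth_harm y x = (\<Sum>b | b \<in> {1..x} \<and> smooth y b. 1 / real b)"

text \<open>The products of arbitrary \<open>a \<le> y\<close>, which are smooth, with rough
  \<open>b \<le> x\<close> are distinct and at most \<open>y * x\<close>. Hence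
  \<open>rough_harm\<close> times a harmonic sum of size \<open>ln y\<close> is part of the harmonic
  sum up to \<open>y * x\<close>.\<close>

lemma rough_harm_upper:
  assumes "2 \<le> y" "0 < x"
  shows "rough_harm y x \<le> (1 + ln (real x) + ln (real y)) / ln (real y)"
proof -
  let ?B = "{b. b \<in> {1..x} \<and> rough y b}"
  have "ln (real y) * rough_harm y x \<le> (\<Sum>a=1..y. 1 / real a) * rough_harm y x"
  proof (intro mult_right_mono)
    have "ln (real y) \<le> ln (real y + 1)" using assms by simp
    then show "ln (real y) \<le> (\<Sum>a=1..y. 1 / real a)" using sum_inverse_bounds(1)[of y] by linarith
  qed (auto simp: rough_harm_def intro: sum_nonneg)
  also have "\<dots> = (\<Sum>a=1..y. \<Sum>b\<in>?B. 1 / real a * (1 / real b))"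
    unfolding rough_harm_def by (rule sum_product)
  also have "\<dots> = (\<Sum>(a, b)\<in>{1..y} \<times> ?B. 1 / real a * (1 / real b))"
    by (rule sum.cartesian_product)
  also have "\<dots> = (\<Sum>(a, b)\<in>{1..y} \<times> ?B. 1 / real (a * b))"
    by (rule sum.cong[OF refl]) (simp add: case_prod_unfold)
  also have "\<dots> = (\<Sum>n\<in>(\<lambda>(a, b). a * b) ` ({1..y} \<times> ?B). 1 / real n)"
  proof (subst sum.reindex)
    show "inj_on (\<lambda>(a, b). a * b) ({1..y} \<times> ?B)"
      by (rule inj_on_smooth_rough[of _ y]) (auto intro: smooth_le)
  qed (simp add: case_prod_unfold)
  also have "\<dots> \<le> (\<Sum>n=1..y * x. 1 / real n)"
  proof (intro sum_mono2 subsetI)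
    fix n assume "n \<in> (\<lambda>(a, b). a * b) ` ({1..y} \<times> ?B)"
    then obtain a b where "n = a * b" "1 \<le> a" "a \<le> y" "1 \<le> b" "b \<le> x" by auto
    then show "n \<in> {1..y * x}" using mult_le_mono[of a y b x] by simp
  qed simp_all
  also have "\<dots> \<le> 1 + ln (real (y * x))" using assms by (intro sum_inverse_bounds) auto
  also have "\<dots> = 1 + ln (real x) + ln (real y)" using assms by (simp add: ln_mult)
  finally show ?thesis using assms by (simp add: pos_le_divide_eq mult.commute)
qed

text \<open>Every \<open>n \<le> x\<close> is such a product with both factors at most
  \<open>x\<close>. An upper bound for \<open>smooth_harm\<close> thereby becomes a lower bound for
  \<open>rough_harm\<close>.\<close>

lemma harm_le_smooth_rough: "(\<Sum>n=1..x. 1 / real n) \<le> smooth_harm y x * rough_harm y x"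
proof -
  let ?A = "{b. b \<in> {1..x} \<and> smooth y b}" and ?B = "{b. b \<in> {1..x} \<and> rough y b}"
  have "(\<Sum>n=1..x. 1 / real n) \<le> (\<Sum>n\<in>(\<lambda>(a, b). a * b) ` (?A \<times> ?B). 1 / real n)"
  proof (intro sum_mono2 subsetI)
    fix n assume n: "n \<in> {1..x}"
    then have "0 < n" by simp
    then obtain a b where ab: "n = a * b" "smooth y a" "rough y b"
      using smooth_rough_decomposition[of n y] by blast
    then have "a dvd n" "b dvd n" by simp_all
    then have "a \<le> n" "b \<le> n" using \<open>0 < n\<close> by (simp_all add: dvd_imp_le)
    moreover have "0 < a" "0 < b" using smooth_pos[OF ab(2)] rough_pos[OF ab(3)] .
    ultimately have "(a, b) \<in> ?A \<times> ?B" using ab(2,3) n by simp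
    then have "(\<lambda>(a, b). a * b) (a, b) \<in> (\<lambda>(a, b). a * b) ` (?A \<times> ?B)" by (rule imageI)
    then show "n \<in> (\<lambda>(a, b). a * b) ` (?A \<times> ?B)" using ab(1) by simp
  qed auto
  also have "\<dots> = (\<Sum>(a, b)\<in>?A \<times> ?B. 1 / real (a * b))"
  proof (subst sum.reindex)
    show "inj_on (\<lambda>(a, b). a * b) (?A \<times> ?B)"
      by (rule inj_on_smooth_rough[of _ y]) auto
  qed (simp add: case_prod_unfold)
  also have "\<dots> = (\<Sum>(a, b)\<in>?A \<times> ?B. 1 / real a * (1 / real b))"
    by (rule sum.cong[OF refl]) (simp add: case_prod_unfold)
  also have "\<dots> = (\<Sum>a\<in>?A. \<Sum>b\<in>?B. 1 / real a * (1 / real b))"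
    by (rule sum.cartesian_product[symmetric])
  also have "\<dots> = smooth_harm y x * rough_harm y x"
    unfolding smooth_harm_def rough_harm_def by (rule sum_product[symmetric])
  finally show ?thesis .
qed

text \<open>\<open>ln\<close> is the divisor sum of \<open>mangoldt\<close>, and a number is rough
  exactly when both factors of a factorization are; so the convolution survives the restriction to
  rough numbers.\<close>

lemma ln_sum_rough:
  "(\<Sum>b | b \<in> {1..x} \<and> rough y b. ln (real b))
     = (\<Sum>m | m \<in> {1..x} \<and> rough y m. \<Sum>d | d \<in> {1..x div m} \<and> rough y d. mangoldt d)"
proof -
  have "(\<Sum>b | b \<in> {1..x} \<and> rough y b. ln (real b))
     = (\<Sum>n=1..x. if rough y n then ln (real n) else 0)"
    by (rule sum.inter_filter) simp
  also have "\<dots> = (\<Sum>n=1..x. \<Sum>m | m dvd n. if rough y m \<and> rough y (n div m) then mangoldt (n div m) else 0)"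
  proof (intro sum.cong refl)
    fix n assume "n \<in> {1..x}"
    then have n: "n > 0" by simp
    have "(if rough y n then ln (real n) else 0) = (\<Sum>d | d dvd n. if rough y n then mangoldt d else 0)"
      using mangoldt_sum_nonzero[OF n] by simp
    also have "\<dots> = (\<Sum>m | m dvd n. if rough y n then mangoldt (n div m) else 0)"
      by (rule sum.reindex_bij_witness[where i = "\<lambda>d. n div d" and j = "\<lambda>d. n div d"])
         (use n in auto)
    also have "\<dots> = (\<Sum>m | m dvd n. if rough y m \<and> rough y (n div m) then mangoldt (n div m) else 0)"
    proof (intro sum.cong refl)
      fix m assume "m \<in> {m. m dvd n}"
      then have "rough y n \<longleftrightarrow> rough y m \<and> rough y (n div m)"
        using rough_mult_iff[of y m "n div m"] by simp
      then show "(if rough y n then mangoldt (n div m) else 0)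
        = (if rough y m \<and> rough y (n div m) then mangoldt (n div m) else (0::real))" by simp
    qed
    finally show "(if rough y n then ln (real n) else 0) = \<dots>" .
  qed
  also have "\<dots> = (\<Sum>m=1..x. \<Sum>d=1..x div m. if rough y m \<and> rough y d then mangoldt d else 0)"
    by (rule sum_divisors_eq)
  also have "\<dots> = (\<Sum>m=1..x. if rough y m then (\<Sum>d=1..x div m. if rough y d then mangoldt d else 0) else 0)"
    by (intro sum.cong refl) auto
  also have "\<dots> = (\<Sum>m | m \<in> {1..x} \<and> rough y m. \<Sum>d | d \<in> {1..x div m} \<and> rough y d. mangoldt d)"
    by (simp only: sum.inter_filter[OF finite_atLeastAtMost])
  finally show ?thesis .
qed

text \<open>Weighting every \<open>b\<close> by \<open>ln x\<close> gains the logarithm that is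
  cancelled at the end. Since \<open>ln (x / b) \<le> x / b\<close>, replacing \<open>ln x\<close>
  by \<open>ln b\<close> costs only \<open>x * rough_harm y x\<close>, and the sum of
  \<open>ln b\<close> is of the same size by Chebyshev's upper bound.\<close>

lemma rough_count_upper:
  assumes "2 \<le> y" "y \<le> x"
  shows "rough_count y x \<le> 20 * real x / ln (real y)"
proof -
  let ?B = "{b. b \<in> {1..x} \<and> rough y b}"
  have lny: "ln (real y) \<ge> 2/3" "ln (real y) \<le> ln (real x)"
  proof -
    have "ln 2 \<le> ln (real y)" using assms by simp
    then show "ln (real y) \<ge> 2/3" using ln2_ge_two_thirds by linarith
    show "ln (real y) \<le> ln (real x)" using assms by simp
  qed
  have "rough_count y x * ln (real x) = (\<Sum>b\<in>?B. ln (real x))"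
    by (simp add: rough_count_def)
  also have "\<dots> \<le> (\<Sum>b\<in>?B. ln (real b) + real x * (1 / real b))"
  proof (intro sum_mono)
    fix b assume b: "b \<in> ?B"
    then have "ln (real x / real b) \<le> real x / real b - 1" by (intro ln_le_minus_one) auto
    then show "ln (real x) \<le> ln (real b) + real x * (1 / real b)" using b by (simp add: ln_div)
  qed
  also have "\<dots> = (\<Sum>m\<in>?B. \<Sum>d | d \<in> {1..x div m} \<and> rough y d. mangoldt d) + real x * rough_harm y x"
    by (simp only: sum.distrib ln_sum_rough rough_harm_def sum_distrib_left)
  also have "\<dots> \<le> (\<Sum>m\<in>?B. 4 * real x * (1 / real m)) + real x * rough_harm y x"
  proof (intro add_right_mono sum_mono)
    fix m assume m: "m \<in> ?B"
    have "(\<Sum>d | d \<in> {1..x div m} \<and> rough y d. mangoldt d) \<le> chebyshev (x div m)"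
      unfolding chebyshev_def by (intro sum_mono2) (auto simp: mangoldt_nonneg)
    also have "\<dots> \<le> 4 * real (x div m)" by (rule chebyshev_le)
    also have "\<dots> \<le> 4 * (real x / real m)" using of_nat_div_le_of_nat[of x m, where ?'a = real] by simp
    finally show "(\<Sum>d | d \<in> {1..x div m} \<and> rough y d. mangoldt d) \<le> 4 * real x * (1 / real m)" by simp
  qed
  also have "\<dots> = 5 * real x * rough_harm y x"
    unfolding sum_distrib_left[symmetric] rough_harm_def by simp
  also have "\<dots> \<le> 5 * real x * ((1 + ln (real x) + ln (real y)) / ln (real y))"
    using assms by (intro mult_left_mono rough_harm_upper) auto
  \<comment> \<open>As \<open>ln x \<ge> ln y \<ge> 2/3\<close>, the numerator
    \<open>1 + ln x + ln y\<close> is at most \<open>4 * ln x\<close>; with the factor 5 this makes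
    20.\<close>
  also have "\<dots> \<le> 5 * real x * (4 * ln (real x) / ln (real y))"
    using lny by (intro mult_left_mono divide_right_mono) auto
  also have "\<dots> = (20 * real x / ln (real y)) * ln (real x)" by simp
  finally show ?thesis using lny by (simp only: mult_le_cancel_right_pos)
qed

lemma mangoldt_nonzeroE:
  assumes "mangoldt d \<noteq> (0::real)"
  obtains p k where "prime p" "0 < k" "d = p ^ k"
  using assms by (auto simp: mangoldt_def primepow_def split: if_splits)

text \<open>For a prime power, being smooth and failing to be rough both say that its prime is at
  most \<open>y\<close>. One bound thus serves the smooth sum with weight \<open>1 / d\<close> and
  the discarded non-rough mass with weight 1.\<close>

lemma sum_prime_powers_le:
  fixes g :: "nat \<Rightarrow> real"
  assumes D: "\<And>d. d \<in> D \<Longrightarrow> 0 < d \<and> d \<le> z \<and> (smooth y d \<or> \<not> rough y d)"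
    and K: "\<And>k. 2 ^ k \<le> z \<Longrightarrow> k \<le> K" and g: "\<And>d. 0 \<le> g d"
  shows "(\<Sum>d\<in>D. mangoldt d * g d) \<le> (\<Sum>p | prime p \<and> p \<le> y. \<Sum>k=1..K. ln (real p) * g (p ^ k))"
proof -
  let ?I = "{p. prime p \<and> p \<le> y} \<times> {1..K}"
  have fin: "finite ?I" by simp
  have "D \<subseteq> {..z}" using D by auto
  then have finD: "finite D" by (rule finite_subset) simp
  have "(\<Sum>d\<in>D. mangoldt d * g d) = (\<Sum>d | d \<in> D \<and> mangoldt d \<noteq> (0::real). mangoldt d * g d)"
    using finD by (intro sum.mono_neutral_right) auto
  also have "\<dots> \<le> (\<Sum>d\<in>(\<lambda>(p, k). p ^ k) ` ?I. mangoldt d * g d)"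
  proof (rule sum_mono2)
    show "{d. d \<in> D \<and> mangoldt d \<noteq> (0::real)} \<subseteq> (\<lambda>(p, k). p ^ k) ` ?I"
    proof
      fix d assume d: "d \<in> {d. d \<in> D \<and> mangoldt d \<noteq> (0::real)}"
      then obtain p k where pk: "prime p" "0 < k" "d = p ^ k" by (auto elim: mangoldt_nonzeroE)
      have "p \<le> y"
      proof (cases "smooth y d")
        case True
        then show ?thesis using pk by (auto simp: smooth_def)
      next
        case False
        then obtain q where "prime q" "q dvd d" "q \<le> y"
          using D[of d] d by (auto simp: rough_def not_less)
        moreover from this have "q = p" using pk prime_dvd_power primes_dvd_imp_eq by blast
        ultimately show ?thesis by simp
      qed
      moreover
      have "2 ^ k \<le> p ^ k" using prime_ge_2_nat[OF pk(1)] by (rule power_mono) simp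
      then have "2 ^ k \<le> z" using D[of d] d pk(3) by auto
      then have "k \<le> K" by (rule K)
      ultimately have "(p, k) \<in> ?I" using pk by simp
      then have "(\<lambda>(p, k). p ^ k) (p, k) \<in> (\<lambda>(p, k). p ^ k) ` ?I" by (rule imageI)
      then show "d \<in> (\<lambda>(p, k). p ^ k) ` ?I" using pk by simp
    qed
  qed (use fin g mangoldt_nonneg in auto)
  also have "\<dots> \<le> (\<Sum>i\<in>?I. ((\<lambda>d. mangoldt d * g d) \<circ> (\<lambda>(p, k). p ^ k)) i)"
    using fin by (intro sum_image_le) (auto simp: g mangoldt_nonneg)
  also have "\<dots> = (\<Sum>(p, k)\<in>?I. ln (real p) * g (p ^ k))"
    by (intro sum.cong refl) (auto simp: mangoldt_primepow)
  also have "\<dots> = (\<Sum>p | prime p \<and> p \<le> y. \<Sum>k=1..K. ln (real p) * g (p ^ k))"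
    by (rule sum.cartesian_product[symmetric])
  finally show ?thesis .
qed

lemma inverse_power_sum_le:
  assumes "2 \<le> p" shows "(\<Sum>k=1..K. 1 / real (p ^ k)) \<le> 2 / real p"
proof -
  \<comment> \<open>The subtracted term makes the induction close: it loses enough at each step to
    pay for the next summand.\<close>
  have "(\<Sum>k=1..K. 1 / real (p ^ k)) \<le> 2 / real p - 1 / real p ^ K" if "0 < K" for K
    using that
  proof (induction K rule: nat_induct_non_zero)
    case (Suc n)
    have "2 / real p ^ Suc n \<le> 1 / real p ^ n" using assms by (simp add: field_simps)
    then show ?case using Suc by simp
  qed simp
  note bound = this
  show ?thesis
  proof (cases "K = 0")
    case False
    have "0 \<le> 1 / real p ^ K" by simp
    then show ?thesis using bound[of K] False by linarith
  qed simp
qed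

lemma ln_ge_two_thirds: "2 \<le> (y::nat) \<Longrightarrow> 2/3 \<le> ln (real y)"
proof -
  assume "2 \<le> y"
  then have "ln 2 \<le> ln (real y)" by simp
  then show ?thesis using ln2_ge_two_thirds by linarith
qed

text \<open>The bound does not depend on \<open>x\<close>: higher powers at most double the
  contribution of the primes up to \<open>y\<close>. The constant is \<open>2 * (1 + 6)\<close>,
  since \<open>4 \<le> 6 * ln y\<close>.\<close>

lemma smooth_mangoldt_sum_le:
  assumes "2 \<le> y"
  shows "(\<Sum>d | d \<in> {1..x} \<and> smooth y d. mangoldt d * (1 / real d)) \<le> 14 * ln (real y)"
proof -
  have "(\<Sum>d | d \<in> {1..x} \<and> smooth y d. mangoldt d * (1 / real d))
     \<le> (\<Sum>p | prime p \<and> p \<le> y. \<Sum>k=1..x. ln (real p) * (1 / real (p ^ k)))"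
  proof (rule sum_prime_powers_le)
    fix k :: nat assume "2 ^ k \<le> x"
    then show "k \<le> x" using less_exp[of k] by linarith
  qed auto
  also have "\<dots> = (\<Sum>p | prime p \<and> p \<le> y. ln (real p) * (\<Sum>k=1..x. 1 / real (p ^ k)))"
    by (simp only: sum_distrib_left)
  also have "\<dots> \<le> (\<Sum>p | prime p \<and> p \<le> y. 2 * (mangoldt p / real p))"
  proof (intro sum_mono)
    fix p assume p: "p \<in> {p. prime p \<and> p \<le> y}"
    then have "2 \<le> p" by (auto simp: prime_ge_2_nat)
    then have "ln (real p) * (\<Sum>k=1..x. 1 / real (p ^ k)) \<le> ln (real p) * (2 / real p)"
      by (intro mult_left_mono inverse_power_sum_le) auto
    then show "ln (real p) * (\<Sum>k=1..x. 1 / real (p ^ k)) \<le> 2 * (mangoldt p / real p)"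
      using p by (simp add: mult_ac)
  qed
  also have "\<dots> \<le> (\<Sum>p=1..y. 2 * (mangoldt p / real p))"
    by (intro sum_mono2) (auto simp: mangoldt_nonneg prime_gt_0_nat Suc_leI)
  also have "\<dots> \<le> 2 * (ln (real y) + 4)"
    unfolding sum_distrib_left[symmetric] using mangoldt_div_sum_le[of y] assms by simp
  also have "\<dots> \<le> 14 * ln (real y)" using ln_ge_two_thirds[OF assms] by simp
  finally show ?thesis .
qed

lemma ln_sum_smooth:
  "(\<Sum>a | a \<in> {1..x} \<and> smooth y a. ln (real a) / real a)
     = (\<Sum>m | m \<in> {1..x} \<and> smooth y m. 1 / real m *
         (\<Sum>d | d \<in> {1..x div m} \<and> smooth y d. mangoldt d * (1 / real d)))"
proof -
  have "(\<Sum>a | a \<in> {1..x} \<and> smooth y a. ln (real a) / real a)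
     = (\<Sum>n=1..x. if smooth y n then ln (real n) / real n else 0)"
    by (rule sum.inter_filter) simp
  also have "\<dots> = (\<Sum>n=1..x. \<Sum>m | m dvd n. if smooth y m \<and> smooth y (n div m)
      then 1 / real m * (mangoldt (n div m) * (1 / real (n div m))) else 0)"
  proof (intro sum.cong refl)
    fix n assume "n \<in> {1..x}"
    then have n: "n > 0" by simp
    have "(if smooth y n then ln (real n) / real n else 0)
        = (\<Sum>d | d dvd n. if smooth y n then mangoldt d / real n else 0)"
      using mangoldt_sum_nonzero[OF n] by (simp flip: sum_divide_distrib)
    also have "\<dots> = (\<Sum>m | m dvd n. if smooth y n then mangoldt (n div m) / real n else 0)"
      by (rule sum.reindex_bij_witness[where i = "\<lambda>d. n div d" and j = "\<lambda>d. n div d"])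
         (use n in auto)
    also have "\<dots> = (\<Sum>m | m dvd n. if smooth y m \<and> smooth y (n div m)
      then 1 / real m * (mangoldt (n div m) * (1 / real (n div m))) else 0)"
    proof (intro sum.cong refl)
      fix m assume "m \<in> {m. m dvd n}"
      then have m: "smooth y n \<longleftrightarrow> smooth y m \<and> smooth y (n div m)" "real n = real m * real (n div m)"
        using smooth_mult_iff[of y m "n div m"] by (simp_all flip: of_nat_mult)
      show "(if smooth y n then mangoldt (n div m) / real n else 0)
        = (if smooth y m \<and> smooth y (n div m)
      then 1 / real m * (mangoldt (n div m) * (1 / real (n div m))) else 0)"
        unfolding m by simp
    qed
    finally show "(if smooth y n then ln (real n) / real n else 0) = \<dots>" .
  qed
  also have "\<dots> = (\<Sum>m=1..x. \<Sum>d=1..x div m. if smooth y m \<and> smooth y d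
      then 1 / real m * (mangoldt d * (1 / real d)) else 0)"
    by (rule sum_divisors_eq)
  also have "\<dots> = (\<Sum>m=1..x. if smooth y m then 1 / real m *
     (\<Sum>d=1..x div m. if smooth y d then mangoldt d * (1 / real d) else 0) else 0)"
    by (intro sum.cong refl) (auto simp: sum_distrib_left intro!: sum.cong)
  also have "\<dots> = (\<Sum>m | m \<in> {1..x} \<and> smooth y m. 1 / real m *
         (\<Sum>d | d \<in> {1..x div m} \<and> smooth y d. mangoldt d * (1 / real d)))"
    by (simp only: sum.inter_filter[OF finite_atLeastAtMost])
  finally show ?thesis .
qed

text \<open>The mean of \<open>ln a\<close> with respect to the weights \<open>1 / a\<close> is at most
  \<open>14 * ln y\<close>, so by Markov's inequality at least half of the mass lies on
  \<open>a \<le> y ^ 28\<close>, where it is at most a harmonic sum.\<close>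

lemma smooth_harm_upper:
  assumes y: "2 \<le> y"
  shows "smooth_harm y x \<le> 60 * ln (real y)"
proof -
  let ?A = "{a. a \<in> {1..x} \<and> smooth y a}"
  let ?S = "smooth_harm y x" and ?l = "28 * ln (real y)"
  have l: "2/3 \<le> ln (real y)" using ln_ge_two_thirds[OF y] .
  have T: "(\<Sum>a\<in>?A. ln (real a) / real a) \<le> ?S * (14 * ln (real y))"
  proof -
    have "(\<Sum>a\<in>?A. ln (real a) / real a) \<le> (\<Sum>m\<in>?A. 1 / real m * (14 * ln (real y)))"
      unfolding ln_sum_smooth by (intro sum_mono mult_left_mono smooth_mangoldt_sum_le y) auto
    then show ?thesis by (simp add: smooth_harm_def sum_distrib_right)
  qed
  have "?S \<le> (\<Sum>a\<in>?A. (if a \<le> y ^ 28 then 1 / real a else 0) + ln (real a) / real a / ?l)"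
    unfolding smooth_harm_def
  proof (intro sum_mono)
    fix a assume "a \<in> ?A"
    then have a: "1 \<le> a" by simp
    show "1 / real a \<le> (if a \<le> y ^ 28 then 1 / real a else 0) + ln (real a) / real a / ?l"
    proof (cases "a \<le> y ^ 28")
      case True
      then show ?thesis using l a by simp
    next
      case False
      then have "real (y ^ 28) \<le> real a" unfolding of_nat_le_iff by linarith
      then have "ln (real (y ^ 28)) \<le> ln (real a)" using y by (intro ln_mono) auto
      then have "?l \<le> ln (real a)" using y by (simp add: ln_realpow)
      then have "1 \<le> ln (real a) / ?l" using l by (simp add: pos_le_divide_eq)
      then have "1 / real a * 1 \<le> 1 / real a * (ln (real a) / ?l)" using a by (intro mult_left_mono) auto
      then show ?thesis using False by simp
    qed
  qed
  also have "\<dots> = (\<Sum>a\<in>?A. if a \<le> y ^ 28 then 1 / real a else 0) + (\<Sum>a\<in>?A. ln (real a) / real a) / ?l"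
    by (simp add: sum.distrib sum_divide_distrib)
  also have "(\<Sum>a\<in>?A. ln (real a) / real a) / ?l \<le> ?S * (14 * ln (real y)) / ?l"
    using T l by (intro divide_right_mono) auto
  also have "?S * (14 * ln (real y)) / ?l = ?S / 2" using l by simp
  also have "(\<Sum>a\<in>?A. if a \<le> y ^ 28 then 1 / real a else 0) = (\<Sum>a | a \<in> ?A \<and> a \<le> y ^ 28. 1 / real a)"
    by (rule sum.inter_filter[symmetric]) simp
  also have "\<dots> \<le> (\<Sum>a=1..y ^ 28. 1 / real a)" by (intro sum_mono2) auto
  also have "\<dots> \<le> 1 + ln (real (y ^ 28))" using y by (intro sum_inverse_bounds) auto
  also have "\<dots> = 1 + ?l" using y by (simp add: ln_realpow)
  finally show ?thesis using l by simp
qed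

lemma rough_harm_lower:
  assumes "2 \<le> y"
  shows "ln (real x + 1) / (60 * ln (real y)) \<le> rough_harm y x"
proof -
  have "ln (real x + 1) \<le> smooth_harm y x * rough_harm y x"
    using sum_inverse_bounds(1)[of x] harm_le_smooth_rough[of x y] by linarith
  also have "\<dots> \<le> 60 * ln (real y) * rough_harm y x"
    by (intro mult_right_mono smooth_harm_upper assms) (auto simp: rough_harm_def intro!: sum_nonneg)
  finally show ?thesis using ln_ge_two_thirds[OF assms]
    by (subst pos_divide_le_eq) (auto simp: mult_ac)
qed

text \<open>Of the total mass \<open>z / 2\<close>, prime powers with \<open>p \<le> y\<close> take
  at most \<open>z / 4\<close>: there are at most \<open>y\<close> such primes, each with few powers
  up to \<open>z\<close>.\<close>

lemma rough_chebyshev_lower: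
  assumes y: "100 \<le> y" and z: "y ^ 4 \<le> z"
  shows "real z / 4 \<le> (\<Sum>d | d \<in> {1..z} \<and> rough y d. mangoldt d)"
proof -
  \<comment> \<open>The fourth root of \<open>z\<close> dominates \<open>y\<close>. Number of
    primes, number of exponents and \<open>ln p\<close> are at most \<open>t\<close>,
    \<open>6 * t\<close> and \<open>t\<close>, and \<open>6 * t ^ 3 \<le> t ^ 4 / 4\<close> because
    \<open>t \<ge> 100\<close>.\<close>
  define t where "t = sqrt (sqrt (real z))"
  have t0: "0 \<le> t" by (simp add: t_def)
  have "t ^ 4 = (t ^ 2) ^ 2" by simp
  also have "\<dots> = real z" by (simp add: t_def)
  finally have t4: "t ^ 4 = real z" .
  have "real y ^ 4 \<le> t ^ 4" unfolding t4 using z by (metis of_nat_le_iff of_nat_power)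
  then have ty: "real y \<le> t" using t0 power_strict_mono[of t "real y" 4] by (meson linorder_not_le zero_less_numeral)
  have yz: "y \<le> z" using z self_le_power[of y 4] y by linarith
  have z0: "0 < z" using yz y by linarith
  let ?K = "nat \<lfloor>6 * t\<rfloor>"
  have "(\<Sum>d | d \<in> {1..z} \<and> \<not> rough y d. mangoldt d * 1)
      \<le> (\<Sum>p | prime p \<and> p \<le> y. \<Sum>k=1..?K. ln (real p) * 1)"
  proof (rule sum_prime_powers_le)
    fix k :: nat assume "2 ^ k \<le> z"
    then have "real (2 ^ k) \<le> real z" by (simp only: of_nat_le_iff)
    then have "ln (2 ^ k) \<le> ln (real z)" by (intro ln_mono) auto
    then have "real k * ln 2 \<le> ln (t ^ 4)" unfolding t4 by (simp add: ln_realpow)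
    then have "real k * ln 2 \<le> 4 * ln t" using ty y by (simp add: ln_realpow)
    also have "ln t \<le> t - 1" using ty y by (intro ln_le_minus_one) auto
    finally have "real k * ln 2 \<le> 4 * t" by simp
    moreover have "real k * (2/3) \<le> real k * ln 2" using ln2_ge_two_thirds by (intro mult_left_mono) auto
    ultimately have "real k \<le> 6 * t" by simp
    then show "k \<le> ?K" by (simp add: le_nat_floor)
  qed auto
  also have "\<dots> \<le> (\<Sum>p | prime p \<and> p \<le> y. (6 * t) * t)"
  proof (intro sum_mono)
    fix p assume p: "p \<in> {p. prime p \<and> p \<le> y}"
    then have "1 \<le> p" using prime_gt_0_nat[of p] by simp
    then have "ln (real p) \<le> real p - 1" by (intro ln_le_minus_one) auto
    then have "ln (real p) \<le> t" using p ty by simp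
    moreover have "real ?K \<le> 6 * t" using t0 by simp
    ultimately have "real ?K * ln (real p) \<le> (6 * t) * t"
      using t0 \<open>1 \<le> p\<close> by (intro mult_mono) auto
    then show "(\<Sum>k=1..?K. ln (real p) * 1) \<le> (6 * t) * t" by simp
  qed
  also have "\<dots> \<le> (\<Sum>p=1..y. (6 * t) * t)"
    using t0 by (intro sum_mono2) (auto simp: Suc_leI prime_gt_0_nat)
  also have "\<dots> = real y * (6 * t * t)" by simp
  also have "\<dots> \<le> t * (6 * t * t)" using ty t0 by (intro mult_right_mono) auto
  also have "\<dots> = 6 * t ^ 3" by (simp add: power3_eq_cube)
  also have "\<dots> \<le> (t / 4) * t ^ 3" using ty y t0 by (intro mult_right_mono) auto
  also have "\<dots> = t ^ 4 / 4" by (simp add: power3_eq_cube power4_eq_xxxx)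
  also have "\<dots> = real z / 4" by (simp only: t4)
  finally have bad: "(\<Sum>d | d \<in> {1..z} \<and> \<not> rough y d. mangoldt d) \<le> real z / 4" by simp
  have "real z / 2 \<le> chebyshev z" using y yz by (intro chebyshev_ge) auto
  also have "chebyshev z = (\<Sum>d | d \<in> {1..z} \<and> rough y d. mangoldt d)
      + (\<Sum>d | d \<in> {1..z} \<and> \<not> rough y d. mangoldt d)"
    unfolding chebyshev_def by (subst sum.union_disjoint[symmetric]) (auto intro!: sum.cong)
  finally show ?thesis using bad by simp
qed

text \<open>The sum of \<open>ln b\<close> over rough \<open>b \<le> x\<close> is at most
  \<open>ln x\<close> times the count. Its convolution form, restricted to small cofactors
  \<open>m\<close>, is bounded below by Chebyshev's lower bound and
  \<open>rough_harm_lower\<close>.\<close>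

lemma rough_count_lower:
  assumes y: "100 \<le> y" and x: "y ^ 8 \<le> x"
  shows "real x / (1920 * ln (real y)) \<le> rough_count y x"
proof -
  let ?B = "\<lambda>x. {b. b \<in> {1..x} \<and> rough y b}"
  \<comment> \<open>For \<open>m \<le> w\<close> the quotient \<open>x div m\<close> is at least
    \<open>y ^ 4\<close>, as \<open>rough_chebyshev_lower\<close> demands. Still
    \<open>x \<le> w ^ 3\<close>, so restricting \<open>m\<close> costs only a factor 3 in the
    logarithm.\<close>
  define w where "w = x div y ^ 4"
  have l: "2/3 \<le> ln (real y)" using ln_ge_two_thirds[of y] y by simp
  have "y ^ 4 * y ^ 4 \<le> x" using x by (simp flip: power_add)
  then have wy: "y ^ 4 \<le> w" unfolding w_def using y by (simp add: less_eq_div_iff_mult_less_eq)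
  have w100: "100 \<le> w" using wy y self_le_power[of y 4] by linarith
  have wx: "w \<le> x" unfolding w_def by simp
  have "x < y ^ 4 * (w + 1)" unfolding w_def using y dividend_less_times_div[of "y ^ 4" x] by simp
  also have "\<dots> \<le> w * (w * w)"
  proof (rule mult_le_mono[OF wy])
    have "w + 1 \<le> 2 * w" using w100 by simp
    also have "\<dots> \<le> w * w" using w100 by (intro mult_le_mono) auto
    finally show "w + 1 \<le> w * w" .
  qed
  finally have "real x \<le> real (w ^ 3)" by (simp add: power3_eq_cube del: of_nat_mult)
  then have "ln (real x) \<le> ln (real (w ^ 3))" using wx w100 by (intro ln_mono) auto
  then have lnx: "ln (real x) \<le> 3 * ln (real w)" using w100 by (simp add: ln_realpow)
  have "real x / 8 * (ln (real w) / (60 * ln (real y))) \<le> real x / 8 * rough_harm y w"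
  proof (intro mult_left_mono)
    have "ln (real w) / (60 * ln (real y)) \<le> ln (real w + 1) / (60 * ln (real y))"
      using w100 l by (intro divide_right_mono) auto
    also have "\<dots> \<le> rough_harm y w" using y by (intro rough_harm_lower) auto
    finally show "ln (real w) / (60 * ln (real y)) \<le> rough_harm y w" .
  qed auto
  also have "\<dots> = (\<Sum>m\<in>?B w. real x / 8 * (1 / real m))"
    by (simp only: rough_harm_def sum_distrib_left)
  also have "\<dots> \<le> (\<Sum>m\<in>?B w. \<Sum>d\<in>?B (x div m). mangoldt d)"
  proof (intro sum_mono)
    fix m assume m: "m \<in> ?B w"
    then have "y ^ 4 * m \<le> y ^ 4 * w" by simp
    also have "\<dots> \<le> x" unfolding w_def by simp
    finally have z: "y ^ 4 \<le> x div m" using m by (simp add: less_eq_div_iff_mult_less_eq)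
    moreover have "0 < y ^ 4" using y by simp
    ultimately have "0 < x div m" by linarith
    have "x < m * (x div m + 1)" using m dividend_less_times_div[of m x] by simp
    also have "\<dots> \<le> m * (2 * (x div m))" using \<open>0 < x div m\<close> by (intro mult_le_mono) auto
    finally have "real x \<le> real (m * (2 * (x div m)))" by (simp only: of_nat_le_iff)
    then have "real x / 8 * (1 / real m) \<le> real (x div m) / 4" using m by (simp add: field_simps)
    also have "\<dots> \<le> (\<Sum>d\<in>?B (x div m). mangoldt d)" by (intro rough_chebyshev_lower y z)
    finally show "real x / 8 * (1 / real m) \<le> (\<Sum>d\<in>?B (x div m). mangoldt d)" .
  qed
  also have "\<dots> \<le> (\<Sum>m\<in>?B x. \<Sum>d\<in>?B (x div m). mangoldt d)"
    using wx by (intro sum_mono2 sum_nonneg mangoldt_nonneg) auto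
  also have "\<dots> = (\<Sum>b\<in>?B x. ln (real b))" by (rule ln_sum_rough[symmetric])
  also have "\<dots> \<le> (\<Sum>b\<in>?B x. ln (real x))" by (intro sum_mono) auto
  also have "\<dots> = rough_count y x * ln (real x)" by (simp add: rough_count_def)
  also have "\<dots> \<le> rough_count y x * (3 * ln (real w))"
    using lnx by (intro mult_left_mono) (auto simp: rough_count_def)
  \<comment> \<open>Here \<open>1440 = 8 * 60 * 3\<close>: the factor 8 is the quarter of
    \<open>x div m\<close> with a factor 2 for rounding, 60 belongs to
    \<open>rough_harm_lower\<close>, and 3 to \<open>ln x \<le> 3 * ln w\<close>.\<close>
  finally have "(real x / (1440 * ln (real y))) * ln (real w) \<le> rough_count y x * ln (real w)"
    by (simp add: field_simps)
  moreover have "0 < ln (real w)" using w100 by simp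
  ultimately have "real x / (1440 * ln (real y)) \<le> rough_count y x" by (simp only: mult_le_cancel_right_pos)
  moreover have "real x / (1920 * ln (real y)) \<le> real x / (1440 * ln (real y))"
    using l by (intro divide_left_mono) auto
  ultimately show ?thesis by linarith
qed

section \<open>Divisors and greatest common divisors of rough numbers\<close>

lemma rough_count_le_real: "rough_count y x \<le> real x"
proof -
  have "card {b. b \<in> {1..x} \<and> rough y b} \<le> card {1..x}" by (intro card_mono) auto
  then show ?thesis by (simp add: rough_count_def)
qed

text \<open>The additive 1 covers the range \<open>x < y\<close>, where 1 is the only possible rough
  number.\<close>

lemma rough_count_le:
  assumes "2 \<le> y" shows "rough_count y x \<le> 1 + 20 * real x / ln (real y)"
proof (cases "y \<le> x")
  case True
  then show ?thesis using rough_count_upper[OF assms True] by simp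
next
  case False
  have "{b. b \<in> {1..x} \<and> rough y b} \<subseteq> {1}" using False rough_gt by fastforce
  then have "card {b. b \<in> {1..x} \<and> rough y b} \<le> 1" using card_mono[of "{1::nat}"] by fastforce
  then have "rough_count y x \<le> 1" by (simp add: rough_count_def)
  moreover have "0 \<le> 20 * real x / ln (real y)" using ln_ge_two_thirds[OF assms] by simp
  ultimately show ?thesis by linarith
qed

text \<open>The sum counts pairs of rough numbers with product at most \<open>R\<close>. Bounding
  the second component for each first one gives a main term of order
  \<open>R * ln R / (ln y)\<^sup>2\<close>, which the hypothesis on \<open>ln R\<close> makes linear
  in \<open>R\<close>.\<close>

lemma rough_divisor_sum_le:
  assumes y: "2 \<le> y" "y \<le> R" and K: "ln (real R) \<le> K * (ln (real y))\<^sup>2"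
  shows "(\<Sum>r | r \<in> {1..R} \<and> rough y r. \<Sum>d | d dvd r. 1) \<le> (1 + 80 * K) * real R"
proof -
  have l: "2/3 \<le> ln (real y)" "ln (real y) \<le> ln (real R)" using ln_ge_two_thirds[OF y(1)] y by auto
  have "(\<Sum>r | r \<in> {1..R} \<and> rough y r. \<Sum>d | d dvd r. 1)
      = (\<Sum>n=1..R. if rough y n then \<Sum>d | d dvd n. 1 else (0::real))"
    by (rule sum.inter_filter) simp
  also have "\<dots> = (\<Sum>n=1..R. \<Sum>d | d dvd n. if rough y d \<and> rough y (n div d) then 1 else 0)"
  proof (intro sum.cong refl)
    fix n
    have "(if rough y n then \<Sum>d | d dvd n. 1 else (0::real)) = (\<Sum>d | d dvd n. if rough y n then 1 else 0)"
      by simp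
    also have "\<dots> = (\<Sum>d | d dvd n. if rough y d \<and> rough y (n div d) then 1 else 0)"
    proof (intro sum.cong refl)
      fix d assume "d \<in> {d. d dvd n}"
      then have "rough y n \<longleftrightarrow> rough y d \<and> rough y (n div d)"
        using rough_mult_iff[of y d "n div d"] by simp
      then show "(if rough y n then 1 else 0) = (if rough y d \<and> rough y (n div d) then 1 else (0::real))"
        by simp
    qed
    finally show "(if rough y n then \<Sum>d | d dvd n. 1 else (0::real)) = \<dots>" .
  qed
  also have "\<dots> = (\<Sum>d=1..R. \<Sum>m=1..R div d. if rough y d \<and> rough y m then 1 else 0)"
    by (rule sum_divisors_eq)
  also have "\<dots> = (\<Sum>d=1..R. if rough y d then rough_count y (R div d) else 0)"
    unfolding rough_count_def by (intro sum.cong refl) (simp add: sum.inter_filter[symmetric])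
  also have "\<dots> = (\<Sum>d | d \<in> {1..R} \<and> rough y d. rough_count y (R div d))"
    by (rule sum.inter_filter[symmetric]) simp
  also have "\<dots> \<le> (\<Sum>d | d \<in> {1..R} \<and> rough y d. 1 + 20 * real R / ln (real y) * (1 / real d))"
  proof (intro sum_mono)
    fix d assume d: "d \<in> {d. d \<in> {1..R} \<and> rough y d}"
    have "rough_count y (R div d) \<le> 1 + 20 * real (R div d) / ln (real y)"
      by (rule rough_count_le[OF y(1)])
    also have "\<dots> \<le> 1 + 20 * (real R / real d) / ln (real y)"
      using of_nat_div_le_of_nat[of R d, where ?'a = real] l
      by (intro add_left_mono divide_right_mono mult_left_mono) auto
    finally show "rough_count y (R div d) \<le> 1 + 20 * real R / ln (real y) * (1 / real d)"
      by (simp add: mult_ac)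
  qed
  also have "\<dots> = rough_count y R + 20 * real R / ln (real y) * rough_harm y R"
    unfolding rough_count_def rough_harm_def by (simp only: sum.distrib sum_distrib_left)
  also have "\<dots> \<le> real R + 20 * real R / ln (real y) * (4 * (K * ln (real y)))"
  proof (intro add_mono rough_count_le_real mult_left_mono)
    have "rough_harm y R \<le> (1 + ln (real R) + ln (real y)) / ln (real y)"
      using y by (intro rough_harm_upper) auto
    also have "\<dots> \<le> (4 * (K * (ln (real y))\<^sup>2)) / ln (real y)"
    proof (rule divide_right_mono)
      show "1 + ln (real R) + ln (real y) \<le> 4 * (K * (ln (real y))\<^sup>2)" using l K by linarith
    qed (use l in simp)
    also have "\<dots> = 4 * (K * ln (real y))" using l by (simp add: power2_eq_square)
    finally show "rough_harm y R \<le> 4 * (K * ln (real y))" .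
  qed (use l in simp)
  also have "\<dots> = (1 + 80 * K) * real R"
  proof -
    have "ln (real y) \<noteq> 0" using l by simp
    then show ?thesis by (simp add: algebra_simps)
  qed
  finally show ?thesis .
qed

text \<open>\<open>gcd q r\<close> is one of the common divisors, hence at most their sum.
  Exchanging summations leaves, for each \<open>d dvd r\<close>, a count of rough multiples of
  \<open>d\<close>.\<close>

lemma rough_gcd_sum_le_divisors:
  assumes y: "2 \<le> y" and r: "rough y r"
  shows "(\<Sum>q | q \<in> {1..r} \<and> rough y q. real (gcd q r) / real r)
     \<le> 1 + 20 / ln (real y) * (\<Sum>d | d dvd r. 1)"
proof -
  let ?B = "\<lambda>x. {b. b \<in> {1..x} \<and> rough y b}"
  have r0: "0 < r" using rough_pos[OF r] .
  then have fin: "finite {d. d dvd r}" by (rule finite_divisors_nat)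
  have l: "2/3 \<le> ln (real y)" using ln_ge_two_thirds[OF y] .
  have "(\<Sum>q\<in>?B r. real (gcd q r) / real r)
     \<le> (\<Sum>q\<in>?B r. \<Sum>d | d dvd r. if d dvd q then real d / real r else 0)"
  proof (intro sum_mono)
    fix q
    have "(\<Sum>d\<in>{gcd q r}. if d dvd q then real d / real r else 0)
        \<le> (\<Sum>d | d dvd r. if d dvd q then real d / real r else 0)"
      using fin by (intro sum_mono2) auto
    then show "real (gcd q r) / real r \<le> (\<Sum>d | d dvd r. if d dvd q then real d / real r else 0)" by simp
  qed
  also have "\<dots> = (\<Sum>d | d dvd r. \<Sum>q\<in>?B r. if d dvd q then real d / real r else 0)"
    by (rule sum.swap)
  \<comment> \<open>With \<open>r = d * e\<close> the inner sum is at most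
    \<open>rough_count y e / e\<close>. This is at most 1 for \<open>e = 1\<close>; otherwise
    \<open>e\<close> is rough and exceeds \<open>y\<close>, so the density bound holds without an
    additive term.\<close>
  also have "\<dots> \<le> (\<Sum>d | d dvd r. (if d = r then 1 else 0) + 20 / ln (real y))"
  proof (intro sum_mono)
    fix d assume "d \<in> {d. d dvd r}"
    then obtain e where e: "r = d * e" by (auto elim: dvdE)
    have d0: "0 < d" "0 < e" using e r0 by auto
    have re: "rough y e" using r e by (simp add: rough_mult_iff)
    have "(\<Sum>q\<in>?B r. if d dvd q then real d / real r else 0)
        = (\<Sum>q | q \<in> ?B r \<and> d dvd q. real d / real r)"
      by (rule sum.inter_filter[symmetric]) simp
    also have "\<dots> = real (card {q. q \<in> ?B r \<and> d dvd q}) * (1 / real e)"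
      using e d0 by simp
    also have "\<dots> \<le> rough_count y e * (1 / real e)"
    proof (intro mult_right_mono)
      have "{q. q \<in> ?B r \<and> d dvd q} \<subseteq> (\<lambda>m. d * m) ` ?B e"
        using e d0 by (auto simp: rough_mult_iff elim!: dvdE)
      then have "card {q. q \<in> ?B r \<and> d dvd q} \<le> card (?B e)"
        by (intro surj_card_le) auto
      then show "real (card {q. q \<in> ?B r \<and> d dvd q}) \<le> rough_count y e"
        by (simp add: rough_count_def)
    qed simp
    also have "\<dots> \<le> (if d = r then 1 else 0) + 20 / ln (real y)"
    proof (cases "e = 1")
      case True
      then have "rough_count y e \<le> 1" using rough_count_le_real[of y 1] by simp
      moreover have "0 \<le> 20 / ln (real y)" using l by simp
      ultimately have "rough_count y e \<le> 1 + 20 / ln (real y)" by linarith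
      then show ?thesis using True e by simp
    next
      case False
      then have "y \<le> e" using rough_gt[OF re] by simp
      then have "rough_count y e * (1 / real e) \<le> 20 * real e / ln (real y) * (1 / real e)"
        by (intro mult_right_mono rough_count_upper y) auto
      then show ?thesis using d0 e False by simp
    qed
    finally show "(\<Sum>q\<in>?B r. if d dvd q then real d / real r else 0)
      \<le> (if d = r then 1 else 0) + 20 / ln (real y)" .
  qed
  also have "\<dots> = 1 + 20 / ln (real y) * (\<Sum>d | d dvd r. 1)"
    using fin by (simp add: sum.distrib)
  finally show ?thesis .
qed

text \<open>Both contributions, the count of rough \<open>r\<close> and their divisors divided by
  \<open>ln y\<close>, are of order \<open>R / ln y\<close>, the size of the rough set itself. This
  is the gain over all integers.\<close>

lemma rough_gcd_sum_le:
  assumes y: "2 \<le> y" "y \<le> R" and K: "ln (real R) \<le> K * (ln (real y))\<^sup>2"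
  shows "(\<Sum>r | r \<in> {1..R} \<and> rough y r. \<Sum>q | q \<in> {1..r} \<and> rough y q. real (gcd q r) / real r)
     \<le> 20 * (2 + 80 * K) * real R / ln (real y)"
proof -
  have l: "2/3 \<le> ln (real y)" using ln_ge_two_thirds[OF y(1)] .
  have "(\<Sum>r | r \<in> {1..R} \<and> rough y r. \<Sum>q | q \<in> {1..r} \<and> rough y q. real (gcd q r) / real r)
     \<le> (\<Sum>r | r \<in> {1..R} \<and> rough y r. 1 + 20 / ln (real y) * (\<Sum>d | d dvd r. 1))"
    by (intro sum_mono rough_gcd_sum_le_divisors y(1)) auto
  also have "\<dots> = rough_count y R
      + 20 / ln (real y) * (\<Sum>r | r \<in> {1..R} \<and> rough y r. \<Sum>d | d dvd r. 1)"
    unfolding rough_count_def by (simp only: sum.distrib sum_distrib_left)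
  also have "\<dots> \<le> 20 * real R / ln (real y) + 20 / ln (real y) * ((1 + 80 * K) * real R)"
    using l by (intro add_mono rough_count_upper y mult_left_mono rough_divisor_sum_le K) auto
  also have "\<dots> = 20 * (2 + 80 * K) * real R / ln (real y)"
    using l by (simp add: field_simps)
  finally show ?thesis .
qed

text \<open>Partial summation against a decreasing weight preserves inequalities between partial
  sums. These are known only from \<open>X\<close> on; below \<open>X\<close> the constancy of
  \<open>\<phi>\<close> reduces the comparison to the partial sum at \<open>X\<close>.\<close>

lemma abel_sum_mono:
  fixes f g \<phi> :: "nat \<Rightarrow> real"
  assumes XZ: "1 \<le> X" "X \<le> Z"
    and le: "\<And>R. X \<le> R \<Longrightarrow> R \<le> Z \<Longrightarrow> (\<Sum>q=1..R. f q) \<le> (\<Sum>q=1..R. g q)"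
    and const: "\<And>q. q \<le> X \<Longrightarrow> \<phi> q = \<phi> X"
    and dec: "\<And>q. X \<le> q \<Longrightarrow> \<phi> (Suc q) \<le> \<phi> q" and nonneg: "\<And>q. 0 \<le> \<phi> q"
  shows "(\<Sum>q=1..Z. f q * \<phi> q) \<le> (\<Sum>q=1..Z. g q * \<phi> q)"
proof -
  define D where "D R = (\<Sum>q=1..R. g q - f q)" for R
  have D0: "0 \<le> D R" if "X \<le> R" "R \<le> Z" for R
    using le[OF that] by (simp add: D_def sum_subtractf)
  \<comment> \<open>The invariant carries the boundary term of the partial summation, so each step
    uses only \<open>D n \<ge> 0\<close> and the decrease of \<open>\<phi>\<close>.\<close>
  have "R \<le> Z \<longrightarrow> \<phi> R * D R \<le> (\<Sum>q=1..R. (g q - f q) * \<phi> q)" if "X \<le> R" for R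
    using that
  proof (induction R rule: dec_induct)
    case base
    have "(\<Sum>q=1..X. (g q - f q) * \<phi> q) = (\<Sum>q=1..X. (g q - f q) * \<phi> X)"
      using const by (intro sum.cong refl) (metis atLeastAtMost_iff)
    also have "\<dots> = \<phi> X * D X" by (simp add: D_def sum_distrib_left mult.commute)
    finally show ?case by simp
  next
    case (step n)
    show ?case
    proof
      assume n: "Suc n \<le> Z"
      have "\<phi> (Suc n) * D n \<le> \<phi> n * D n" using step n by (intro mult_right_mono dec D0) auto
      then have "\<phi> (Suc n) * D (Suc n) \<le> \<phi> n * D n + (g (Suc n) - f (Suc n)) * \<phi> (Suc n)"
        by (simp add: D_def algebra_simps)
      then show "\<phi> (Suc n) * D (Suc n) \<le> (\<Sum>q=1..Suc n. (g q - f q) * \<phi> q)"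
        using step n by simp
    qed
  qed
  from this[OF XZ(2)] have "\<phi> Z * D Z \<le> (\<Sum>q=1..Z. (g q - f q) * \<phi> q)" by simp
  moreover have "0 \<le> \<phi> Z * D Z" using nonneg D0[OF XZ(2)] by simp
  ultimately show ?thesis by (simp add: left_diff_distrib sum_subtractf)
qed

text \<open>\<open>T\<close> is the first moment to be expected for a set of density
  \<open>1 / ln y\<close>. \<open>y ^ 8 \<le> X\<close> makes the lower count available from
  \<open>X\<close> on, and the bound on \<open>ln Z\<close> makes the gcd bound available up to
  \<open>Z\<close>; both are then carried over to \<open>\<phi>\<close>.\<close>

lemma rough_weighted_sums:
  fixes \<phi> :: "nat \<Rightarrow> real"
  assumes y: "100 \<le> y" and X: "y ^ 8 \<le> X" "X \<le> Z" and K: "ln (real Z) \<le> K * (ln (real y))\<^sup>2"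
    and const: "\<And>q. q \<le> X \<Longrightarrow> \<phi> q = \<phi> X"
    and dec: "\<And>q. X \<le> q \<Longrightarrow> \<phi> (Suc q) \<le> \<phi> q" and nonneg: "\<And>q. 0 \<le> \<phi> q"
  defines "Q \<equiv> {q. q \<in> {1..Z} \<and> rough y q \<and> q \<noteq> 1}"
    and "T \<equiv> (\<Sum>q=1..Z. \<phi> q) / ln (real y)"
  shows "T / 3840 \<le> (\<Sum>q\<in>Q. \<phi> q)"
    and "(\<Sum>r\<in>Q. \<Sum>q | q \<in> Q \<and> q \<le> r. \<phi> r * (real (gcd q r) / real r)) \<le> 20 * (2 + 80 * K) * T"
proof -
  have l: "2/3 \<le> ln (real y)" using ln_ge_two_thirds[of y] y by simp
  have yX: "y \<le> X" using X self_le_power[of y 8] y by linarith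
  have X1: "1 \<le> X" using yX y by simp
  have lnR: "ln (real R) \<le> K * (ln (real y))\<^sup>2" if "X \<le> R" "R \<le> Z" for R
  proof -
    have "ln (real R) \<le> ln (real Z)" using that X1 by (intro ln_mono) auto
    then show ?thesis using K by linarith
  qed
  have "(\<Sum>q=1..Z. 1 / (3840 * ln (real y)) * \<phi> q) \<le> (\<Sum>q=1..Z. (if rough y q \<and> q \<noteq> 1 then 1 else 0) * \<phi> q)"
  proof (rule abel_sum_mono[OF X1 X(2) _ const dec nonneg])
    fix R assume R: "X \<le> R" "R \<le> Z"
    have "y ^ 8 \<le> R" using R X by simp
    \<comment> \<open>Removing \<open>q = 1\<close> lowers the count by 1. Since \<open>R\<close>
      exceeds \<open>3840 * ln y\<close>, passing from the constant 1920 to 3840 pays for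
      it.\<close>
    have "100 ^ 7 * real y \<le> real y ^ 7 * real y" using y by (intro mult_right_mono power_mono) auto
    also have "\<dots> = real (y ^ 8)" by (simp add: power_eq_if)
    also have "\<dots> \<le> real R" using \<open>y ^ 8 \<le> R\<close> by (simp only: of_nat_le_iff)
    finally have "3840 * real y \<le> real R" by simp
    moreover have "ln (real y) \<le> real y - 1" using y by (intro ln_le_minus_one) auto
    ultimately have "3840 * ln (real y) \<le> real R" by simp
    then have "1 \<le> real R / (3840 * ln (real y))" using l by (simp add: pos_le_divide_eq)
    moreover have "real R / (1920 * ln (real y)) \<le> rough_count y R"
      by (rule rough_count_lower[OF y \<open>y ^ 8 \<le> R\<close>])
    moreover have "real R / (1920 * ln (real y)) = 2 * (real R / (3840 * ln (real y)))"
      using l by (simp add: field_simps)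
    ultimately have "real R / (3840 * ln (real y)) \<le> rough_count y R - 1" by linarith
    also have "rough_count y R - 1 = (\<Sum>q | q \<in> {1..R} \<and> (rough y q \<and> q \<noteq> 1). 1)"
    proof -
      have "{b. b \<in> {1..R} \<and> rough y b} = insert 1 {q. q \<in> {1..R} \<and> (rough y q \<and> q \<noteq> 1)}"
        using R X1 by auto
      then show ?thesis unfolding rough_count_def by (simp)
    qed
    also have "\<dots> = (\<Sum>q=1..R. if rough y q \<and> q \<noteq> 1 then 1 else 0)"
      by (rule sum.inter_filter) simp
    finally show "(\<Sum>q=1..R. 1 / (3840 * ln (real y))) \<le> (\<Sum>q=1..R. if rough y q \<and> q \<noteq> 1 then 1 else 0)"
      by simp
  qed
  also have "\<dots> = (\<Sum>q=1..Z. if rough y q \<and> q \<noteq> 1 then \<phi> q else 0)"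
    by (intro sum.cong refl) simp
  also have "\<dots> = (\<Sum>q\<in>Q. \<phi> q)" unfolding Q_def by (rule sum.inter_filter[symmetric]) simp
  finally show "T / 3840 \<le> (\<Sum>q\<in>Q. \<phi> q)"
    by (simp add: T_def mult.commute sum_divide_distrib)
  define h where "h r = (if rough y r then \<Sum>q | q \<in> {1..r} \<and> rough y q. real (gcd q r) / real r else 0)" for r
  have "(\<Sum>r\<in>Q. \<Sum>q | q \<in> Q \<and> q \<le> r. \<phi> r * (real (gcd q r) / real r)) \<le> (\<Sum>r\<in>Q. h r * \<phi> r)"
  proof (intro sum_mono)
    fix r assume r: "r \<in> Q"
    have "(\<Sum>q | q \<in> Q \<and> q \<le> r. \<phi> r * (real (gcd q r) / real r))
       \<le> (\<Sum>q | q \<in> {1..r} \<and> rough y q. \<phi> r * (real (gcd q r) / real r))"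
      using nonneg by (intro sum_mono2) (auto simp: Q_def)
    also have "\<dots> = h r * \<phi> r" using r by (simp add: h_def Q_def sum_distrib_left mult.commute)
    finally show "(\<Sum>q | q \<in> Q \<and> q \<le> r. \<phi> r * (real (gcd q r) / real r)) \<le> h r * \<phi> r" .
  qed
  also have "\<dots> \<le> (\<Sum>r=1..Z. h r * \<phi> r)"
    using nonneg by (intro sum_mono2) (auto simp: Q_def h_def intro!: sum_nonneg)
  also have "\<dots> \<le> (\<Sum>r=1..Z. 20 * (2 + 80 * K) / ln (real y) * \<phi> r)"
  proof (rule abel_sum_mono[OF X1 X(2) _ const dec nonneg])
    fix R assume R: "X \<le> R" "R \<le> Z"
    have "(\<Sum>q=1..R. h q)
       = (\<Sum>r | r \<in> {1..R} \<and> rough y r. \<Sum>q | q \<in> {1..r} \<and> rough y q. real (gcd q r) / real r)"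
      unfolding h_def by (rule sum.inter_filter[symmetric]) simp
    also have "\<dots> \<le> 20 * (2 + 80 * K) * real R / ln (real y)"
      using y yX R by (intro rough_gcd_sum_le lnR) auto
    finally show "(\<Sum>q=1..R. h q) \<le> (\<Sum>q=1..R. 20 * (2 + 80 * K) / ln (real y))"
      by (simp add: mult.commute)
  qed
  also have "\<dots> = 20 * (2 + 80 * K) * T"
    by (simp add: T_def sum_distrib_left sum_divide_distrib)
  finally show "(\<Sum>r\<in>Q. \<Sum>q | q \<in> Q \<and> q \<le> r. \<phi> r * (real (gcd q r) / real r)) \<le> 20 * (2 + 80 * K) * T" .
qed

subsection \<open>Overlaps of the approximation sets\<close>

lemma int_dist_less_iff: "int_dist x < e \<longleftrightarrow> (\<exists>k::int. \<bar>x - of_int k\<bar> < e)"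
proof -
  have ne: "(\<int>::real set) \<noteq> {}" by auto
  have "int_dist x = (INF a\<in>\<int>. dist x a)" unfolding int_dist_def by (rule infdist_notempty[OF ne])
  also have "\<dots> < e \<longleftrightarrow> (\<exists>a\<in>\<int>. dist x a < e)" by (intro cINF_less_iff ne) (auto intro: bdd_belowI[of _ 0])
  also have "\<dots> \<longleftrightarrow> (\<exists>k::int. \<bar>x - of_int k\<bar> < e)" by (auto simp: Ints_def dist_real_def)
  finally show ?thesis .
qed

text \<open>Real values make overlaps products and numbers of hits sums under the integral.\<close>

definition hit :: "real \<Rightarrow> real \<Rightarrow> real" where
  "hit e x = indicat_real {x. int_dist x < e} x"

lemma hit_eq: "hit e x = (if int_dist x < e then 1 else 0)"
  by (simp add: hit_def)

lemma hit_add_int: "hit e (x + of_int k) = hit e x"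
proof -
  have "(\<exists>m::int. \<bar>x + of_int k - of_int m\<bar> < e) \<longleftrightarrow> (\<exists>m::int. \<bar>x - of_int m\<bar> < e)"
  proof
    assume "\<exists>m::int. \<bar>x + of_int k - of_int m\<bar> < e"
    then obtain m :: int where "\<bar>x + of_int k - of_int m\<bar> < e" by blast
    then have "\<bar>x - of_int (m - k)\<bar> < e" by (simp add: algebra_simps)
    then show "\<exists>m::int. \<bar>x - of_int m\<bar> < e" by blast
  next
    assume "\<exists>m::int. \<bar>x - of_int m\<bar> < e"
    then obtain m :: int where "\<bar>x - of_int m\<bar> < e" by blast
    then have "\<bar>x + of_int k - of_int (m + k)\<bar> < e" by (simp add: algebra_simps)
    then show "\<exists>m::int. \<bar>x + of_int k - of_int m\<bar> < e" by blast
  qed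
  then show ?thesis by (simp add: hit_eq int_dist_less_iff)
qed

lemma open_hit: "open {x. int_dist (a * x + b) < e}"
  unfolding int_dist_def by (intro open_Collect_less continuous_intros)

lemma open_integrable_on:
  assumes "open (S :: real set)" shows "indicat_real S integrable_on {a..b}"
proof -
  have "S \<in> sets lebesgue" using assms by (simp add: borel_open)
  then have "cbox a b \<inter> S \<in> lmeasurable"
    by (rule fmeasurable_Int_fmeasurable[OF lmeasurable_cbox])
  then have "S \<inter> {a..b} \<in> lmeasurable" by (simp add: Int_commute)
  then show ?thesis by (simp add: integrable_on_indicator)
qed

lemma hit_integrable: "(\<lambda>x. hit e (a * x + b)) integrable_on {c..d}"
proof -
  have "(\<lambda>x. hit e (a * x + b)) = indicat_real {x. int_dist (a * x + b) < e}"
    by (auto simp: fun_eq_iff hit_def indicator_def)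
  then show ?thesis using open_integrable_on[OF open_hit] by simp
qed

lemma hit_mult_integrable:
  "(\<lambda>x. hit e (a * x + b) * hit e' (a' * x + b')) integrable_on {c..d}"
proof -
  have "(\<lambda>x. hit e (a * x + b) * hit e' (a' * x + b'))
    = indicat_real ({x. int_dist (a * x + b) < e} \<inter> {x. int_dist (a' * x + b') < e'})"
    by (auto simp: fun_eq_iff hit_def indicator_def)
  then show ?thesis using open_integrable_on[OF open_Int[OF open_hit open_hit]] by simp
qed

text \<open>The substitution maps the unit interval to \<open>q\<close> whole periods, all with the
  same integral, and contributes the factor \<open>1 / q\<close>. The case \<open>q = 1\<close> is
  translation invariance.\<close>

lemma periodic_integral_affine:
  fixes F :: "real \<Rightarrow> real"
  assumes int: "\<And>a b. F integrable_on {a..b}" and per: "\<And>x. F (x + 1) = F x" and q: "0 < q"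
  shows "integral {0..1} (\<lambda>x. F (real q * x + c)) = integral {0..1} F"
proof -
  have shift: "integral {a + d..b + d} F = integral {a..b} (\<lambda>x. F (x + d))" for a b d
  proof -
    have "(F has_integral integral {a + d..b + d} F) (cbox (a + d) (b + d))"
      using int[of "a + d" "b + d"] by (simp add: integrable_integral)
    from has_integral_affinity'[OF this, of 1 d]
    show ?thesis by (simp add: integral_unique)
  qed
  have perk: "F (x + of_nat k) = F x" for x k
  proof (induction k)
    case (Suc k)
    have "F (x + of_nat (Suc k)) = F ((x + of_nat k) + 1)" by (simp add: algebra_simps)
    then show ?case using Suc per by simp
  qed simp
  have peri: "F (x + of_int k) = F x" for x k
  proof (cases "0 \<le> k")
    case True
    then show ?thesis using perk[of x "nat k"] by simp
  next
    case False
    then show ?thesis using perk[of "x + of_int k" "nat (- k)"] by simp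
  qed
  have one: "integral {t..t + 1} F = integral {0..1} F" for t
  proof -
    define n where "n = \<lfloor>t\<rfloor>"
    have n: "of_int n \<le> t" "t \<le> of_int n + 1" unfolding n_def by linarith+
    have "integral {t..t + 1} F = integral {t..of_int n + 1} F + integral {of_int n + 1..t + 1} F"
      using n int by (intro Henstock_Kurzweil_Integration.integral_combine[symmetric]) auto
    also have "integral {of_int n + 1..t + 1} F = integral {of_int n..t} F"
      unfolding shift using per by simp
    also have "integral {t..of_int n + 1} F + integral {of_int n..t} F = integral {of_int n..of_int n + 1} F"
      using n int Henstock_Kurzweil_Integration.integral_combine[of "of_int n" t "of_int n + 1" F] by simp
    also have "\<dots> = integral {0..1} F"
      using shift[of 0 "of_int n" 1] peri by (simp add: add.commute)
    finally show ?thesis .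
  qed
  have many: "integral {c..c + real n} F = real n * integral {0..1} F" for n
  proof (induction n)
    case (Suc n)
    have "integral {c..c + real (Suc n)} F
        = integral {c..c + real n} F + integral {c + real n..c + real n + 1} F"
      using int Henstock_Kurzweil_Integration.integral_combine[of c "c + real n" "c + real (Suc n)" F]
      by (simp add: algebra_simps)
    also have "integral {c + real n..c + real n + 1} F = integral {0..1} F" by (rule one)
    finally show ?case using Suc by (simp add: algebra_simps)
  qed simp
  have "(F has_integral integral {c..c + real q} F) (cbox c (c + real q))"
    using int by (simp add: integrable_integral)
  from has_integral_affinity'[OF this, of "real q" c] q
  have "((\<lambda>x. F (real q * x + c)) has_integral integral {c..c + real q} F / real q) {0..1}"
    by (simp add: divide_inverse mult.commute)
  then show ?thesis using many[of q] q by (simp add: integral_unique)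
qed

lemma hit_integral:
  assumes "0 \<le> e" "e \<le> 1 / 2"
  shows "integral {0..1} (hit e) = 2 * e"
proof -
  have int: "hit e integrable_on {a..b}" for a b using hit_integrable[of e 1 0 a b] by simp
  have per: "hit e (x + 1) = hit e x" for x using hit_add_int[of e x 1] by simp
  \<comment> \<open>After a shift by 1/2 the neighbourhood of the integers meets the unit interval
    in one central interval instead of two pieces at its ends.\<close>
  have "integral {0..1} (hit e) = integral {0..1} (\<lambda>x. hit e (real 1 * x + (- 1 / 2)))"
    by (rule periodic_integral_affine[symmetric]) (use int per in auto)
  also have "\<dots> = integral {0..1} (indicat_real {1/2 - e<..<1/2 + e})"
  proof (rule integral_cong)
    fix x :: real assume x: "x \<in> {0..1}"
    have "int_dist (x - 1 / 2) < e \<longleftrightarrow> \<bar>x - 1 / 2\<bar> < e"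
    proof
      assume "int_dist (x - 1 / 2) < e"
      then obtain k :: int where k: "\<bar>x - 1 / 2 - of_int k\<bar> < e" unfolding int_dist_less_iff by blast
      have "-1 < real_of_int k" "real_of_int k < 1" using k x assms by (auto simp: abs_less_iff)
      then have "k = 0" by linarith
      then show "\<bar>x - 1 / 2\<bar> < e" using k by simp
    next
      assume "\<bar>x - 1 / 2\<bar> < e"
      then show "int_dist (x - 1 / 2) < e" unfolding int_dist_less_iff by (intro exI[of _ 0]) simp
    qed
    then show "hit e (real 1 * x + (- 1 / 2)) = indicat_real {1/2 - e<..<1/2 + e} x"
      by (auto simp: hit_eq indicator_def abs_less_iff)
  qed
  also have "\<dots> = measure lebesgue ({1/2 - e<..<1/2 + e} \<inter> {0..1})"
    by (rule integral_indicator) (auto intro!: fmeasurable.Int)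
  also have "{1/2 - e<..<1/2 + e} \<inter> {0..1} = {1/2 - e<..<1/2 + e}" using assms by auto
  also have "measure lebesgue \<dots> = 2 * e" using assms by simp
  finally show ?thesis .
qed

lemma hit_affine_integral:
  assumes "0 \<le> e" "e \<le> 1 / 2" "0 < q"
  shows "integral {0..1} (\<lambda>x. hit e (real q * x + c)) = 2 * e"
proof -
  have "integral {0..1} (\<lambda>x. hit e (real q * x + c)) = integral {0..1} (hit e)"
  proof (rule periodic_integral_affine[OF _ _ assms(3)])
    show "hit e integrable_on {a..b}" for a b using hit_integrable[of e 1 0 a b] by simp
    show "hit e (x + 1) = hit e x" for x using hit_add_int[of e x 1] by simp
  qed
  then show ?thesis using hit_integral assms by simp
qed

text \<open>As \<open>p\<close> is coprime to \<open>n\<close>, the points are equally spaced modulo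
  1 at distance \<open>1 / n\<close>, and an arc of length \<open>2 * e\<close> contains at most
  \<open>2 * e * n + 1\<close> of them.\<close>

lemma hit_orbit_sum_le:
  assumes "coprime p n" "0 < n" "0 \<le> e"
  shows "(\<Sum>j<n. hit e (x + real p * real j / real n)) \<le> 2 * e * real n + 1"
proof -
  define J where "J = {j \<in> {..<n}. int_dist (x + real p * real j / real n) < e}"
  have "\<forall>j\<in>J. \<exists>k::int. \<bar>x + real p * real j / real n - of_int k\<bar> < e"
    by (auto simp: J_def int_dist_less_iff)
  then obtain k :: "nat \<Rightarrow> int" where k: "\<And>j. j \<in> J \<Longrightarrow> \<bar>x + real p * real j / real n - of_int (k j)\<bar> < e"
    by metis
  \<comment> \<open>Multiplying by \<open>n\<close> clears denominators: the hits become integers in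
    an open interval of length \<open>2 * e * n\<close>, distinct because of coprimality.\<close>
  define t where "t j = int p * int j - k j * int n" for j
  define a where "a = - x * real n - e * real n"
  define b where "b = - x * real n + e * real n"
  have tj: "a < of_int (t j)" "of_int (t j) < b" if "j \<in> J" for j
  proof -
    have "\<bar>x + real p * real j / real n - of_int (k j)\<bar> * real n < e * real n"
      using k[OF that] assms by (intro mult_strict_right_mono) auto
    also have "\<bar>x + real p * real j / real n - of_int (k j)\<bar> * real n
        = \<bar>(x + real p * real j / real n - of_int (k j)) * real n\<bar>"
      by (simp add: abs_mult)
    also have "(x + real p * real j / real n - of_int (k j)) * real n = x * real n + of_int (t j)"
      using assms by (simp add: t_def field_simps)
    finally show "a < of_int (t j)" "of_int (t j) < b" by (auto simp: a_def b_def abs_less_iff)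
  qed
  have inj: "inj_on t J"
  proof (rule inj_onI)
    fix i j assume ij: "i \<in> J" "j \<in> J" "t i = t j"
    then have "int p * (int i - int j) = int n * (k i - k j)" by (simp add: t_def algebra_simps)
    then have "int n dvd int p * (int i - int j)" by simp
    moreover have "coprime (int n) (int p)" using assms by (simp add: coprime_commute)
    ultimately have "int n dvd int i - int j" by (simp add: coprime_dvd_mult_right_iff)
    moreover have "\<bar>int i - int j\<bar> < int n" using ij by (auto simp: J_def)
    ultimately have "int i - int j = 0" using dvd_imp_le_int[of "int i - int j" "int n"] by force
    then show "i = j" by simp
  qed
  have "finite J" by (simp add: J_def)
  have "t ` J \<subseteq> {\<lfloor>a\<rfloor> + 1..\<lceil>b\<rceil> - 1}"
  proof
    fix s assume "s \<in> t ` J"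
    then obtain j where "j \<in> J" "s = t j" by blast
    then have "a < of_int s" "of_int s < b" using tj by auto
    then show "s \<in> {\<lfloor>a\<rfloor> + 1..\<lceil>b\<rceil> - 1}" by (simp add: floor_less_iff less_ceiling_iff add1_zle_eq)
  qed
  then have "card (t ` J) \<le> card {\<lfloor>a\<rfloor> + 1..\<lceil>b\<rceil> - 1}" by (intro card_mono) auto
  then have "card J \<le> nat (\<lceil>b\<rceil> - 1 - \<lfloor>a\<rfloor>)" using card_image[OF inj] by simp
  moreover have "real (nat (\<lceil>b\<rceil> - 1 - \<lfloor>a\<rfloor>)) \<le> b - a + 1"
  proof (cases "0 \<le> \<lceil>b\<rceil> - 1 - \<lfloor>a\<rfloor>")
    case True
    then have "real (nat (\<lceil>b\<rceil> - 1 - \<lfloor>a\<rfloor>)) = of_int \<lceil>b\<rceil> - 1 - of_int \<lfloor>a\<rfloor>" by simp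
    also have "\<dots> \<le> b - a + 1" by linarith
    finally show ?thesis .
  next
    case False
    moreover have "0 \<le> b - a" using assms by (simp add: a_def b_def)
    ultimately show ?thesis by simp
  qed
  ultimately have "real (card J) \<le> b - a + 1" by linarith
  also have "b - a + 1 = 2 * e * real n + 1" by (simp add: a_def b_def)
  also have "real (card J) = (\<Sum>j<n. hit e (x + real p * real j / real n))"
    unfolding hit_eq J_def by (subst sum.inter_filter[symmetric]) auto
  finally show ?thesis .
qed

text \<open>The second factor is invariant under translation by \<open>j / r\<close>, while over
  \<open>j < r / gcd q r\<close> these translations move the argument of the first factor through equally
  spaced points modulo 1.\<close>

lemma hit_overlap_integral_le:
  assumes q: "0 < q" and r: "0 < r" and e: "0 \<le> e" and e': "0 \<le> e'" "e' \<le> 1 / 2"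
  shows "integral {0..1} (\<lambda>x. hit e (real q * x + c) * hit e' (real r * x + c'))
     \<le> 2 * e' * (2 * e + real (gcd q r) / real r)"
proof -
  define g where "g = gcd q r"
  define p where "p = q div g"
  define n where "n = r div g"
  have g: "0 < g" "q = p * g" "r = n * g" using q by (auto simp: g_def p_def n_def)
  have n: "0 < n" using g r by (auto intro: Nat.gr0I)
  have cop: "coprime p n" unfolding p_def n_def g_def using q by (intro div_gcd_coprime) auto
  define F where "F x = hit e (real q * x + c) * hit e' (real r * x + c')" for x
  have int: "F integrable_on {a..b}" for a b unfolding F_def by (rule hit_mult_integrable)
  have per: "F (x + 1) = F x" for x
    using hit_add_int[of e "real q * x + c" "int q"] hit_add_int[of e' "real r * x + c'" "int r"]
    by (simp add: F_def algebra_simps)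
  have shift: "F (x + real j / real r)
      = hit e (real q * x + c + real p * real j / real n) * hit e' (real r * x + c')" for x j
  proof -
    have "real q * (real j / real r) = real p * real j / real n" using g n by simp
    then have "real q * (x + real j / real r) + c = real q * x + c + real p * real j / real n"
      by (simp add: distrib_left)
    moreover have "real r * (x + real j / real r) + c' = real r * x + c' + of_int (int j)"
      using r by (simp add: distrib_left)
    ultimately show ?thesis unfolding F_def by (simp only: hit_add_int)
  qed
  have int': "(\<lambda>x. F (x + d)) integrable_on {a..b}" for a b d
  proof -
    have "(\<lambda>x. hit e (real q * x + (real q * d + c)) * hit e' (real r * x + (real r * d + c'))) integrable_on {a..b}"
      by (rule hit_mult_integrable)
    then show ?thesis by (simp add: F_def algebra_simps)
  qed
  have "real n * integral {0..1} F = (\<Sum>j<n. integral {0..1} (\<lambda>x. F (x + real j / real r)))"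
    using periodic_integral_affine[OF int per, of 1] by simp
  also have "\<dots> = integral {0..1} (\<lambda>x. \<Sum>j<n. F (x + real j / real r))"
    by (rule integral_sum[symmetric]) (auto intro: int')
  also have "\<dots> \<le> integral {0..1} (\<lambda>x. (2 * e * real n + 1) * hit e' (real r * x + c'))"
  proof (rule integral_le)
    show "(\<lambda>x. \<Sum>j<n. F (x + real j / real r)) integrable_on {0..1}"
      by (intro integrable_sum int') auto
    show "(\<lambda>x. (2 * e * real n + 1) * hit e' (real r * x + c')) integrable_on {0..1}"
      using integrable_on_cmult_iff[of "2 * e * real n + 1"] hit_integrable e
      by (intro integrable_on_mult_right) auto
    fix x
    have "(\<Sum>j<n. F (x + real j / real r))
        = (\<Sum>j<n. hit e (real q * x + c + real p * real j / real n)) * hit e' (real r * x + c')"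
      by (simp add: shift sum_distrib_right)
    also have "\<dots> \<le> (2 * e * real n + 1) * hit e' (real r * x + c')"
      by (intro mult_right_mono hit_orbit_sum_le cop n e) (auto simp: hit_def)
    finally show "(\<Sum>j<n. F (x + real j / real r)) \<le> (2 * e * real n + 1) * hit e' (real r * x + c')" .
  qed
  also have "\<dots> = (2 * e * real n + 1) * (2 * e')"
    using hit_affine_integral[OF e' r] by simp
  also have "\<dots> = real n * (2 * e' * (2 * e + real g / real r))"
    using g n by (simp add: field_simps)
  finally show ?thesis using n unfolding F_def g_def by simp
qed

subsection \<open>Second moments\<close>

text \<open>The hit counter \<open>F\<close> has mean \<open>M\<close> and vanishes on
  \<open>B\<close>, so \<open>M\<^sup>2\<close> times the measure of \<open>B\<close> is at most the
  integral of \<open>(F x - M)\<^sup>2\<close>, which is at most \<open>4 * E\<close>. As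
  \<open>M\<close> is twice the sum of \<open>\<phi>\<close>, the factors 4 cancel.\<close>

lemma unhit_measure_le:
  fixes \<phi> \<gamma> :: "nat \<Rightarrow> real"
  assumes fin: "finite Q" and pos: "\<And>q. q \<in> Q \<Longrightarrow> 0 < q"
    and \<phi>: "\<And>q. q \<in> Q \<Longrightarrow> 0 \<le> \<phi> q \<and> \<phi> q \<le> 1 / 2"
  defines "B \<equiv> {x \<in> {0..1}. \<forall>q\<in>Q. \<not> int_dist (real q * x - \<gamma> q) < \<phi> q}"
  shows "B \<in> lmeasurable"
    and "measure lebesgue B * (\<Sum>q\<in>Q. \<phi> q)\<^sup>2
      \<le> (\<Sum>r\<in>Q. \<Sum>q | q \<in> Q \<and> q \<le> r. \<phi> r * (real (gcd q r) / real r))"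
proof -
  define E where "E = (\<Sum>r\<in>Q. \<Sum>q | q \<in> Q \<and> q \<le> r. \<phi> r * (real (gcd q r) / real r))"
  define M where "M = 2 * (\<Sum>q\<in>Q. \<phi> q)"
  define h where "h q x = hit (\<phi> q) (real q * x + - \<gamma> q)" for q x
  define F where "F x = (\<Sum>q\<in>Q. h q x)" for x
  define U where "U = (\<Union>q\<in>Q. {x. int_dist (real q * x + - \<gamma> q) < \<phi> q})"
  have B_eq: "B = cbox 0 1 \<inter> - U" by (auto simp: B_def U_def)
  have "open U" unfolding U_def by (intro open_UN ballI open_hit)
  then have "closed (- U)" by (rule closed_Compl)
  then have "- U \<in> sets lebesgue" by (simp only: borel_closed sets_completionI_sets sets_lborel)
  then show meas: "B \<in> lmeasurable"
    unfolding B_eq by (rule fmeasurable_Int_fmeasurable[OF lmeasurable_cbox])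
  have hint: "h q integrable_on {0..1}" for q
    unfolding h_def by (rule hit_integrable)
  have hhint: "(\<lambda>x. h q x * h r x) integrable_on {0..1}" for q r
    unfolding h_def by (rule hit_mult_integrable)
  have Fint: "F integrable_on {0..1}"
    unfolding F_def by (intro integrable_sum fin hint)
  have FF: "F x * F x = (\<Sum>q\<in>Q. \<Sum>r\<in>Q. h q x * h r x)" for x
    unfolding F_def by (rule sum_product)
  have FFint: "(\<lambda>x. F x * F x) integrable_on {0..1}"
    unfolding FF by (intro integrable_sum fin hhint)
  have intF: "integral {0..1} F = M"
  proof -
    have "integral {0..1} F = (\<Sum>q\<in>Q. integral {0..1} (h q))"
      unfolding F_def by (intro integral_sum fin hint)
    also have "\<dots> = (\<Sum>q\<in>Q. 2 * \<phi> q)"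
      unfolding h_def using \<phi> pos by (intro sum.cong refl hit_affine_integral) auto
    finally show ?thesis by (simp add: M_def sum_distrib_left)
  qed
  \<comment> \<open>The overlap bound is asymmetric in \<open>q\<close> and \<open>r\<close>. Adding
    \<open>err r q\<close> gives a bound for both orders; the diagonal is counted twice, at no
    harm.\<close>
  define err where "err q r = (if q \<le> r then 2 * (\<phi> r * (real (gcd q r) / real r)) else 0)" for q r
  have overlap: "integral {0..1} (\<lambda>x. h q x * h r x) \<le> (2 * \<phi> q) * (2 * \<phi> r) + (err q r + err r q)"
    if "q \<in> Q" "r \<in> Q" for q r
  proof -
    have le: "integral {0..1} (\<lambda>x. h q x * h r x) \<le> (2 * \<phi> q) * (2 * \<phi> r) + err q r"
      if "q \<in> Q" "r \<in> Q" "q \<le> r" for q r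
    proof -
      have "integral {0..1} (\<lambda>x. h q x * h r x)
          \<le> 2 * \<phi> r * (2 * \<phi> q + real (gcd q r) / real r)"
        unfolding h_def using that \<phi> pos by (intro hit_overlap_integral_le) auto
      then show ?thesis using that by (simp add: err_def algebra_simps)
    qed
    have nn: "0 \<le> err q r" "0 \<le> err r q" using \<phi> that by (auto simp: err_def)
    show ?thesis
    proof (cases "q \<le> r")
      case True
      then show ?thesis using le[of q r] that nn by linarith
    next
      case False
      then have "integral {0..1} (\<lambda>x. h r x * h q x) \<le> (2 * \<phi> r) * (2 * \<phi> q) + err r q"
        using le[of r q] that by simp
      then show ?thesis using nn by (simp add: mult.commute)
    qed
  qed
  have errsum: "(\<Sum>q\<in>Q. \<Sum>r\<in>Q. err q r) = 2 * E"
  proof -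
    have "(\<Sum>q\<in>Q. \<Sum>r\<in>Q. err q r) = (\<Sum>r\<in>Q. \<Sum>q\<in>Q. err q r)" by (rule sum.swap)
    also have "\<dots> = (\<Sum>r\<in>Q. \<Sum>q | q \<in> Q \<and> q \<le> r. 2 * (\<phi> r * (real (gcd q r) / real r)))"
      unfolding err_def by (intro sum.cong refl sum.inter_filter[symmetric] fin)
    finally show ?thesis by (simp add: E_def sum_distrib_left)
  qed
  have "integral {0..1} (\<lambda>x. F x * F x) = (\<Sum>q\<in>Q. \<Sum>r\<in>Q. integral {0..1} (\<lambda>x. h q x * h r x))"
    unfolding FF by (simp add: integral_sum fin hhint integrable_sum)
  also have "\<dots> \<le> (\<Sum>q\<in>Q. \<Sum>r\<in>Q. (2 * \<phi> q) * (2 * \<phi> r) + (err q r + err r q))"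
    by (intro sum_mono overlap)
  also have "\<dots> = (\<Sum>q\<in>Q. \<Sum>r\<in>Q. (2 * \<phi> q) * (2 * \<phi> r)) + ((\<Sum>q\<in>Q. \<Sum>r\<in>Q. err q r) + (\<Sum>q\<in>Q. \<Sum>r\<in>Q. err r q))"
    by (simp only: sum.distrib)
  also have "(\<Sum>q\<in>Q. \<Sum>r\<in>Q. err r q) = (\<Sum>q\<in>Q. \<Sum>r\<in>Q. err q r)" by (rule sum.swap)
  also have "(\<Sum>q\<in>Q. \<Sum>r\<in>Q. (2 * \<phi> q) * (2 * \<phi> r)) = M * M"
  proof -
    have "M = (\<Sum>q\<in>Q. 2 * \<phi> q)" by (simp add: M_def sum_distrib_left)
    then show ?thesis by (simp only: sum_product)
  qed
  finally have second: "integral {0..1} (\<lambda>x. F x * F x) \<le> M * M + 4 * E" unfolding errsum by simp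
  have Bint: "indicat_real B integrable_on {0..1}"
    using meas by (simp add: integrable_on_indicator fmeasurable_Int_fmeasurable)
  have "M * M * measure lebesgue B = integral {0..1} (\<lambda>x. M * M * indicat_real B x)"
  proof -
    have "integral {0..1} (indicat_real B) = measure lebesgue (B \<inter> {0..1})"
      using meas by (intro integral_indicator fmeasurable_Int_fmeasurable) auto
    also have "B \<inter> {0..1} = B" by (auto simp: B_def)
    finally show ?thesis by simp
  qed
  also have "\<dots> \<le> integral {0..1} (\<lambda>x. F x * F x - 2 * M * F x + M * M)"
  proof (rule integral_le)
    show "(\<lambda>x. M * M * indicat_real B x) integrable_on {0..1}"
      using Bint by (rule integrable_on_mult_right)
    show "(\<lambda>x. F x * F x - 2 * M * F x + M * M) integrable_on {0..1}"
      by (intro integrable_add integrable_diff FFint integrable_on_mult_right Fint integrable_const_ivl)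
    fix x
    have sq: "F x * F x - 2 * M * F x + M * M = (F x - M)\<^sup>2" by (simp add: power2_eq_square algebra_simps)
    show "M * M * indicat_real B x \<le> F x * F x - 2 * M * F x + M * M"
    proof (cases "x \<in> B")
      case True
      then have "F x = 0" unfolding F_def h_def by (intro sum.neutral) (auto simp: hit_eq B_def)
      then show ?thesis using True by simp
    next
      case False
      then show ?thesis unfolding sq by simp
    qed
  qed
  also have "\<dots> = integral {0..1} (\<lambda>x. F x * F x) - 2 * M * M + M * M"
  proof -
    have "integral {0..1} (\<lambda>x. F x * F x - 2 * M * F x + M * M)
       = integral {0..1} (\<lambda>x. F x * F x - 2 * M * F x) + integral {0..1::real} (\<lambda>x. M * M)"
      by (intro Henstock_Kurzweil_Integration.integral_add integrable_diff FFint
            integrable_on_mult_right Fint integrable_const_ivl)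
    also have "integral {0..1} (\<lambda>x. F x * F x - 2 * M * F x)
       = integral {0..1} (\<lambda>x. F x * F x) - integral {0..1} (\<lambda>x. 2 * M * F x)"
      by (intro Henstock_Kurzweil_Integration.integral_diff FFint integrable_on_mult_right Fint)
    finally show ?thesis using intF by simp
  qed
  also have "\<dots> \<le> 4 * E" using second by simp
  finally show "measure lebesgue B * (\<Sum>q\<in>Q. \<phi> q)\<^sup>2
      \<le> (\<Sum>r\<in>Q. \<Sum>q | q \<in> Q \<and> q \<le> r. \<phi> r * (real (gcd q r) / real r))"
    unfolding E_def[symmetric] by (simp add: M_def power2_eq_square algebra_simps)
qed

text \<open>A point missed by all \<open>q > N\<close> with tolerance \<open>\<psi>\<close> is
  missed by all \<open>q \<in> Q\<close> with the smaller tolerance \<open>\<phi>\<close>. Such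
  points have outer measure at most every \<open>e\<close>, and the complement of \<open>W\<close>
  is a countable union of these null sets.\<close>

lemma measure_W_eq_1I:
  fixes \<psi> \<gamma> :: "nat \<Rightarrow> real"
  assumes "\<And>N e. 0 < e \<Longrightarrow> \<exists>Q \<phi>. finite Q \<and> (\<forall>q\<in>Q. N < q \<and> 0 \<le> \<phi> q \<and> \<phi> q \<le> 1 / 2 \<and> \<phi> q \<le> \<psi> q)
    \<and> 0 < (\<Sum>q\<in>Q. \<phi> q)
    \<and> (\<Sum>r\<in>Q. \<Sum>q | q \<in> Q \<and> q \<le> r. \<phi> r * (real (gcd q r) / real r)) \<le> e * (\<Sum>q\<in>Q. \<phi> q)\<^sup>2"
  shows "measure lebesgue (W \<psi> \<gamma>) = 1"
proof -
  define A where "A N = {x \<in> {0..1}. \<forall>q>N. \<not> int_dist (real q * x - \<gamma> q) < \<psi> q}" for N :: nat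
  have neg: "negligible (A N)" for N
    unfolding negligible_outer_le
  proof (intro allI impI)
    fix e :: real assume "0 < e"
    from assms[OF this, of N] obtain Q \<phi> where Q: "finite Q"
      "\<And>q. q \<in> Q \<Longrightarrow> N < q \<and> 0 \<le> \<phi> q \<and> \<phi> q \<le> 1 / 2 \<and> \<phi> q \<le> \<psi> q"
      and S: "0 < (\<Sum>q\<in>Q. \<phi> q)"
      and E: "(\<Sum>r\<in>Q. \<Sum>q | q \<in> Q \<and> q \<le> r. \<phi> r * (real (gcd q r) / real r)) \<le> e * (\<Sum>q\<in>Q. \<phi> q)\<^sup>2"
      by auto
    define B where "B = {x \<in> {0..1}. \<forall>q\<in>Q. \<not> int_dist (real q * x - \<gamma> q) < \<phi> q}"
    have "0 < q" if "q \<in> Q" for q using Q(2)[OF that] by simp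
    moreover have "0 \<le> \<phi> q \<and> \<phi> q \<le> 1 / 2" if "q \<in> Q" for q using Q(2)[OF that] by simp
    ultimately have B: "B \<in> lmeasurable"
      "measure lebesgue B * (\<Sum>q\<in>Q. \<phi> q)\<^sup>2
      \<le> (\<Sum>r\<in>Q. \<Sum>q | q \<in> Q \<and> q \<le> r. \<phi> r * (real (gcd q r) / real r))"
      unfolding B_def using unhit_measure_le[OF Q(1)] by blast+
    have "measure lebesgue B * (\<Sum>q\<in>Q. \<phi> q)\<^sup>2 \<le> e * (\<Sum>q\<in>Q. \<phi> q)\<^sup>2" using B(2) E by linarith
    moreover have "0 < (\<Sum>q\<in>Q. \<phi> q)\<^sup>2" using S by simp
    ultimately have "measure lebesgue B \<le> e" by (simp only: mult_le_cancel_right_pos)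
    moreover have "A N \<subseteq> B"
    proof
      fix x assume x: "x \<in> A N"
      have "\<not> int_dist (real q * x - \<gamma> q) < \<phi> q" if "q \<in> Q" for q
        using x Q(2)[OF that] by (force simp: A_def)
      then show "x \<in> B" using x by (simp add: A_def B_def)
    qed
    ultimately show "\<exists>T. A N \<subseteq> T \<and> T \<in> lmeasurable \<and> measure lebesgue T \<le> e" using B(1) by blast
  qed
  have "W \<psi> \<gamma> = {0..1} - (\<Union>N. A N)"
  proof (rule set_eqI)
    fix x
    have "finite {q. 1 \<le> q \<and> int_dist (real q * x - \<gamma> q) < \<psi> q}
      \<longleftrightarrow> (\<exists>N. \<forall>q>N. \<not> int_dist (real q * x - \<gamma> q) < \<psi> q)"
    proof
      assume "finite {q. 1 \<le> q \<and> int_dist (real q * x - \<gamma> q) < \<psi> q}"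
      then obtain N where N: "\<And>q. 1 \<le> q \<Longrightarrow> int_dist (real q * x - \<gamma> q) < \<psi> q \<Longrightarrow> q \<le> N"
        unfolding finite_nat_set_iff_bounded_le by blast
      have "\<not> int_dist (real q * x - \<gamma> q) < \<psi> q" if "N < q" for q
        using N[of q] that by linarith
      then show "\<exists>N. \<forall>q>N. \<not> int_dist (real q * x - \<gamma> q) < \<psi> q" by blast
    next
      assume "\<exists>N. \<forall>q>N. \<not> int_dist (real q * x - \<gamma> q) < \<psi> q"
      then obtain N where "\<forall>q>N. \<not> int_dist (real q * x - \<gamma> q) < \<psi> q" by blast
      then show "finite {q. 1 \<le> q \<and> int_dist (real q * x - \<gamma> q) < \<psi> q}"
        unfolding finite_nat_set_iff_bounded_le by (intro exI[of _ N]) (auto simp: not_less[symmetric])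
    qed
    then show "x \<in> W \<psi> \<gamma> \<longleftrightarrow> x \<in> {0..1} - (\<Union>N. A N)" by (auto simp: W_def A_def)
  qed
  moreover have "negligible (\<Union>N. A N)" by (rule negligible_Union_nat[OF neg])
  then have "measure lebesgue ({0..1} - (\<Union>N. A N)) = measure lebesgue {0..1::real}"
    by (intro measure_negligible_symdiff) (auto intro: negligible_subset)
  ultimately show ?thesis by simp
qed

text \<open>Every real lies within 1/2 of an integer. This settles the case in which a decreasing
  \<open>\<psi>\<close> never drops to the range where hit probabilities equal
  \<open>2 * \<psi> q\<close>.\<close>

lemma W_eq_unit_interval:
  assumes "\<And>q. 1 \<le> q \<Longrightarrow> 1 / 2 < \<psi> q" shows "W \<psi> \<gamma> = {0..1}"
proof -
  have "int_dist (real q * x - \<gamma> q) < \<psi> q" if "1 \<le> q" for q x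
    using assms[OF that] of_int_round_abs_le[of "real q * x - \<gamma> q"] unfolding int_dist_less_iff
    by (intro exI[of _ "round (real q * x - \<gamma> q)"]) (simp add: abs_minus_commute)
  then have "{q. 1 \<le> q \<and> int_dist (real q * x - \<gamma> q) < \<psi> q} = {1..}" for x by auto
  then show ?thesis by (auto simp: W_def infinite_Ici)
qed

subsection \<open>Divergence over blocks\<close>

lemma antimono_of_Suc:
  fixes \<psi> :: "nat \<Rightarrow> real"
  assumes "\<And>q. 1 \<le> q \<Longrightarrow> \<psi> (q + 1) \<le> \<psi> q" "1 \<le> a" "a \<le> b"
  shows "\<psi> b \<le> \<psi> a"
  using assms(3)
proof (induction b rule: dec_induct)
  case (step n)
  then show ?case using assms(1)[of n] assms(2) by simp
qed simp

lemma measure_W_of_unbounded_blocks: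
  fixes \<gamma> \<psi> :: "nat \<Rightarrow> real"
  assumes nonneg: "\<And>q. 1 \<le> q \<Longrightarrow> 0 \<le> \<psi> q"
    and decreasing: "\<And>q. 1 \<le> q \<Longrightarrow> \<psi> (q + 1) \<le> \<psi> q"
    and unbounded: "\<And>C N. \<exists>n\<ge>N. C \<le> (\<Sum>q\<in>{2 ^ 4 ^ n..<2 ^ 4 ^ Suc n}. \<psi> q) / 2 ^ n"
  shows "measure lebesgue (W \<psi> \<gamma>) = 1"
proof (cases "\<forall>q\<ge>1. 1 / 2 < \<psi> q")
  case True
  then show ?thesis using W_eq_unit_interval[of \<psi> \<gamma>] by simp
next
  case False
  then obtain q0 where q0: "1 \<le> q0" "\<psi> q0 \<le> 1 / 2" by (auto simp: not_less)
  have anti: "\<psi> b \<le> \<psi> a" if "1 \<le> a" "a \<le> b" for a b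
    using antimono_of_Suc[of \<psi> a b] decreasing that by blast
  show ?thesis
  proof (rule measure_W_eq_1I)
    fix N :: nat and e :: real assume e: "0 < e"
    \<comment> \<open>\<open>9640 = 20 * (2 + 80 * 6)\<close> is the gcd constant for
      \<open>K = 6\<close>, and 3840 is the loss in the first moment.\<close>
    define c :: real where "c = 9640 * 3840"
    \<comment> \<open>\<open>N\<close> forces all rough \<open>q\<close> beyond \<open>N\<close>,
      \<open>q0\<close> puts \<open>\<phi>\<close> below 1/2, and 10 gives
      \<open>y \<ge> 100\<close> and \<open>y ^ 8 \<le> X\<close>.\<close>
    obtain n where n: "N + q0 + 10 \<le> n"
      and blk: "3840 * (c / e) \<le> (\<Sum>q\<in>{2 ^ 4 ^ n..<2 ^ 4 ^ Suc n}. \<psi> q) / 2 ^ n"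
      using unbounded[of "N + q0 + 10" "3840 * (c / e)"] by blast
    define y :: nat where "y = 2 ^ 2 ^ n"
    define X :: nat where "X = 2 ^ 4 ^ n"
    define Z :: nat where "Z = 2 ^ 4 ^ Suc n"
    \<comment> \<open>Freezing \<open>\<psi>\<close> below \<open>X\<close> provides the constancy
      needed for partial summation and the bound 1/2, and monotonicity keeps \<open>\<phi>\<close>
      below \<open>\<psi>\<close>. Rough \<open>q\<close> smaller than \<open>X\<close> may then
      stay in \<open>Q\<close>.\<close>
    define \<phi> where "\<phi> q = \<psi> (max q X)" for q
    define Q where "Q = {q. q \<in> {1..Z} \<and> rough y q \<and> q \<noteq> 1}"
    define T where "T = (\<Sum>q=1..Z. \<phi> q) / ln (real y)"
    define S where "S = (\<Sum>q\<in>Q. \<phi> q)"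
    have n2: "n < 2 ^ n" by (rule less_exp)
    have n4: "n < 4 ^ n" by (induction n) auto
    have ny: "n < y" using n2 less_exp[of "2 ^ n"] unfolding y_def by linarith
    have y100: "100 \<le> y"
    proof -
      have "(2::nat) ^ 7 \<le> 2 ^ 2 ^ n" using n n2 by (intro power_increasing; linarith)
      then show ?thesis by (simp add: y_def)
    qed
    have nX: "n < X" using n4 less_exp[of "4 ^ n"] unfolding X_def by linarith
    have X1: "1 \<le> X" using nX by simp
    have XZ: "X \<le> Z" unfolding X_def Z_def by (intro power_increasing) auto
    have sq: "(4::nat) ^ n = 2 ^ n * 2 ^ n" by (simp flip: power_mult_distrib)
    have yX: "y ^ 8 \<le> X"
    proof -
      have "2 ^ n * 8 \<le> (4::nat) ^ n" unfolding sq using n n2 by (intro mult_le_mono; linarith)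
      then show ?thesis unfolding y_def X_def by (simp add: power_increasing flip: power_mult)
    qed
    have lny: "ln (real y) = 2 ^ n * ln 2" by (simp add: y_def ln_realpow)
    \<comment> \<open>\<open>ln Z\<close> is \<open>4 * 4 ^ n * ln 2\<close> and
      \<open>(ln y)\<^sup>2\<close> is \<open>4 ^ n * (ln 2)\<^sup>2\<close>, so 6 works because
      \<open>4 \<le> 6 * ln 2\<close>.\<close>
    have K: "ln (real Z) \<le> 6 * (ln (real y))\<^sup>2"
    proof -
      have "ln (real Z) = 4 ^ n * (ln 2 * 4)" by (simp add: Z_def ln_realpow)
      also have "\<dots> \<le> 4 ^ n * (ln 2 * (6 * ln 2))"
        using ln2_ge_two_thirds by (intro mult_left_mono) auto
      also have "\<dots> = 6 * (ln (real y))\<^sup>2"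
        by (simp add: lny power2_eq_square flip: power_mult_distrib)
      finally show ?thesis .
    qed
    have \<phi>0: "0 \<le> \<phi> q" for q using nonneg X1 by (simp add: \<phi>_def)
    have \<phi>half: "\<phi> q \<le> 1 / 2" for q
    proof -
      have "q0 \<le> max q X" using n nX by linarith
      from anti[OF q0(1) this] show ?thesis using q0(2) by (simp add: \<phi>_def)
    qed
    have \<phi>\<psi>: "\<phi> q \<le> \<psi> q" if "1 \<le> q" for q
      using anti[OF that, of "max q X"] by (simp add: \<phi>_def)
    have const: "\<phi> q = \<phi> X" if "q \<le> X" for q using that by (simp add: \<phi>_def max_def)
    have dec: "\<phi> (Suc q) \<le> \<phi> q" if "X \<le> q" for q
      using that decreasing[of q] X1 by (simp add: \<phi>_def max_def)
    have ST: "T / 3840 \<le> S"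
      unfolding S_def T_def Q_def by (rule rough_weighted_sums(1)[OF y100 yX XZ K const dec \<phi>0])
    have ET: "(\<Sum>r\<in>Q. \<Sum>q | q \<in> Q \<and> q \<le> r. \<phi> r * (real (gcd q r) / real r)) \<le> 9640 * T"
      using rough_weighted_sums(2)[OF y100 yX XZ K const dec \<phi>0] unfolding T_def Q_def by simp
    have "(\<Sum>q\<in>{X..<Z}. \<psi> q) / 2 ^ n \<le> T"
    proof -
      have "(\<Sum>q\<in>{X..<Z}. \<psi> q) = (\<Sum>q\<in>{X..<Z}. \<phi> q)"
        by (intro sum.cong refl) (simp add: \<phi>_def max_absorb1)
      also have "\<dots> \<le> (\<Sum>q=1..Z. \<phi> q)" using X1 \<phi>0 by (intro sum_mono2) auto
      finally have "(\<Sum>q\<in>{X..<Z}. \<psi> q) / 2 ^ n \<le> (\<Sum>q=1..Z. \<phi> q) / 2 ^ n"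
        by (rule divide_right_mono) simp
      also have "\<dots> \<le> T" unfolding T_def lny
      proof (rule divide_left_mono)
        show "2 ^ n * ln 2 \<le> (2::real) ^ n" using ln_2_less_1 by (simp add: mult_le_cancel_left1)
        show "0 \<le> (\<Sum>q=1..Z. \<phi> q)" by (intro sum_nonneg \<phi>0)
      qed simp
      finally show ?thesis .
    qed
    then have T: "3840 * (c / e) \<le> T" using blk unfolding X_def Z_def by linarith
    then have Sc: "c / e \<le> S" using ST by simp
    have "0 < c / e" using e by (simp add: c_def)
    then have S0: "0 < S" using Sc by linarith
    have "9640 * T \<le> c * S" using ST by (simp add: c_def)
    also have "\<dots> \<le> (e * S) * S" using Sc S0 e by (intro mult_right_mono) (auto simp: field_simps)
    finally have "9640 * T \<le> e * S\<^sup>2" by (simp add: power2_eq_square)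
    then have E: "(\<Sum>r\<in>Q. \<Sum>q | q \<in> Q \<and> q \<le> r. \<phi> r * (real (gcd q r) / real r)) \<le> e * S\<^sup>2"
      using ET by linarith
    have "finite Q" by (simp add: Q_def)
    moreover have "\<forall>q\<in>Q. N < q \<and> 0 \<le> \<phi> q \<and> \<phi> q \<le> 1 / 2 \<and> \<phi> q \<le> \<psi> q"
    proof
      fix q assume q: "q \<in> Q"
      then have "y < q" by (auto simp: Q_def intro!: rough_gt)
      then show "N < q \<and> 0 \<le> \<phi> q \<and> \<phi> q \<le> 1 / 2 \<and> \<phi> q \<le> \<psi> q"
        using ny n \<phi>0 \<phi>half \<phi>\<psi>[of q] by simp
    qed
    ultimately show "\<exists>Q \<phi>. finite Q \<and> (\<forall>q\<in>Q. N < q \<and> 0 \<le> \<phi> q \<and> \<phi> q \<le> 1 / 2 \<and> \<phi> q \<le> \<psi> q)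
      \<and> 0 < (\<Sum>q\<in>Q. \<phi> q)
      \<and> (\<Sum>r\<in>Q. \<Sum>q | q \<in> Q \<and> q \<le> r. \<phi> r * (real (gcd q r) / real r)) \<le> e * (\<Sum>q\<in>Q. \<phi> q)\<^sup>2"
      using S0 E unfolding S_def by blast
  qed
qed

text \<open>If the normalized block sums stayed below \<open>C\<close> from \<open>N\<close> on, the
  weighted blocks would be dominated by a multiple of \<open>s\<close> and the series would be
  bounded. The factor \<open>2 ^ n\<close> is the density loss of the block, up to a
  constant.\<close>

lemma unbounded_blocks_of_diverges:
  fixes \<psi> w s :: "nat \<Rightarrow> real"
  assumes nonneg: "\<And>q. 1 \<le> q \<Longrightarrow> 0 \<le> \<psi> q"
    and div: "series_diverges (\<lambda>q. \<psi> q * w q)"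
    and w: "\<And>n q. 1 \<le> n \<Longrightarrow> 2 ^ 4 ^ n \<le> q \<Longrightarrow> w q \<le> s n / 2 ^ n"
    and s: "summable s" "\<And>n. 0 \<le> s n"
  shows "\<exists>n\<ge>N. C \<le> (\<Sum>q\<in>{2 ^ 4 ^ n..<2 ^ 4 ^ Suc n}. \<psi> q) / 2 ^ n"
proof (rule ccontr)
  assume contra: "\<not> ?thesis"
  \<comment> \<open>The successor secures \<open>1 \<le> n\<close> for the weight bound; the maximum
    with 0 in \<open>C'\<close> keeps multiplication by it monotone.\<close>
  define M where "M = Suc N"
  define C' where "C' = max C 0"
  define X :: "nat \<Rightarrow> nat" where "X n = 2 ^ 4 ^ n" for n
  have X1: "1 \<le> X n" for n by (simp add: X_def)
  have Xmono: "X n \<le> X (Suc n)" for n unfolding X_def by (intro power_increasing) auto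
  have Xn: "n < X n" for n
  proof -
    have "n < 4 ^ n" by (induction n) auto
    then show ?thesis using less_exp[of "4 ^ n"] unfolding X_def by linarith
  qed
  have blk: "(\<Sum>q\<in>{X n..<X (Suc n)}. \<psi> q * w q) \<le> C' * s n" if "M \<le> n" for n
  proof -
    have n: "N \<le> n" "1 \<le> n" using that by (auto simp: M_def)
    have "(\<Sum>q\<in>{X n..<X (Suc n)}. \<psi> q * w q) \<le> (\<Sum>q\<in>{X n..<X (Suc n)}. \<psi> q * (s n / 2 ^ n))"
    proof (intro sum_mono mult_left_mono)
      fix q assume q: "q \<in> {X n..<X (Suc n)}"
      then show "w q \<le> s n / 2 ^ n" using n by (intro w) (auto simp: X_def)
      show "0 \<le> \<psi> q" using q X1[of n] by (intro nonneg) auto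
    qed
    also have "\<dots> = (\<Sum>q\<in>{X n..<X (Suc n)}. \<psi> q) / 2 ^ n * s n"
      by (simp add: sum_distrib_right sum_divide_distrib)
    also have "\<dots> \<le> C' * s n"
    proof (rule mult_right_mono)
      have "\<not> C \<le> (\<Sum>q\<in>{X n..<X (Suc n)}. \<psi> q) / 2 ^ n"
        using contra n(1) unfolding X_def by blast
      then show "(\<Sum>q\<in>{X n..<X (Suc n)}. \<psi> q) / 2 ^ n \<le> C'" by (simp add: C'_def)
    qed (rule s(2))
    finally show ?thesis .
  qed
  define A where "A = (\<Sum>q\<in>{1..<X M}. \<psi> q * w q)"
  have part: "(\<Sum>q\<in>{1..<X n}. \<psi> q * w q) \<le> A + C' * (\<Sum>i\<in>{M..<n}. s i)" if "M \<le> n" for n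
    using that
  proof (induction n rule: dec_induct)
    case (step n)
    have "(\<Sum>q\<in>{1..<X (Suc n)}. \<psi> q * w q)
        = (\<Sum>q\<in>{1..<X n}. \<psi> q * w q) + (\<Sum>q\<in>{X n..<X (Suc n)}. \<psi> q * w q)"
      using X1 Xmono by (intro sum.atLeastLessThan_concat[symmetric])
    then show ?case using step blk[of n] by (simp add: distrib_left)
  qed (simp add: A_def)
  have bound: "(\<Sum>q\<in>{1..<X n}. \<psi> q * w q) \<le> A + C' * suminf s" if "M \<le> n" for n
  proof -
    have "(\<Sum>i\<in>{M..<n}. s i) \<le> suminf s" using s by (intro sum_le_suminf) auto
    then have "C' * (\<Sum>i\<in>{M..<n}. s i) \<le> C' * suminf s" by (intro mult_left_mono) (auto simp: C'_def)
    then show ?thesis using part[OF that] by linarith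
  qed
  have "eventually (\<lambda>R. A + C' * suminf s + 1 \<le> (\<Sum>q=1..R. \<psi> q * w q)) sequentially"
    using div unfolding series_diverges_def filterlim_at_top by blast
  then obtain R0 where R0: "\<And>R. R0 \<le> R \<Longrightarrow> A + C' * suminf s + 1 \<le> (\<Sum>q=1..R. \<psi> q * w q)"
    unfolding eventually_sequentially by blast
  define n where "n = max M (Suc R0)"
  have "R0 < n" by (simp add: n_def)
  then have "R0 \<le> X n - 1" using Xn[of n] by linarith
  from R0[OF this] have "A + C' * suminf s + 1 \<le> (\<Sum>q=1..X n - 1. \<psi> q * w q)" .
  also have "{1..X n - 1} = {1..<X n}" using X1[of n] by auto
  finally show False using bound[of n] by (simp add: n_def)
qed

section \<open>Iterated truncated logarithms and Bertrand series\<close>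

lemma Log_ge_1: "1 \<le> Log x"
  by (simp add: Log_def)

lemma Log_mono: "0 < x \<Longrightarrow> x \<le> y \<Longrightarrow> Log x \<le> Log y"
  unfolding Log_def by (intro max.mono ln_mono) auto

text \<open>Up to \<open>ln x = 2\<close> the truncation at 1 suffices, and beyond that
  \<open>ln 2 < 1 \<le> ln x / 2\<close>. A factor 1/2 thus passes through any number of iterates
  without further loss.\<close>

lemma Log_half: "0 < x \<Longrightarrow> Log x / 2 \<le> Log (x / 2)"
  using ln_2_less_1 by (auto simp: Log_def ln_div max_def)

lemma iter_Log_0 [simp]: "iter_Log 0 x = x"
  by (simp add: iter_Log_def)

lemma iter_Log_Suc: "iter_Log (Suc j) x = Log (iter_Log j x)"
  by (simp add: iter_Log_def)

lemma iter_Log_Suc': "iter_Log (Suc j) x = iter_Log j (Log x)"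
  unfolding iter_Log_def by (simp only: funpow_Suc_right o_apply)

lemma iter_Log_pos: "0 < x \<Longrightarrow> 0 < iter_Log j x"
  using less_le_trans[OF zero_less_one Log_ge_1] by (cases j) (auto simp: iter_Log_Suc)

lemma iter_Log_nonneg: "0 \<le> x \<Longrightarrow> 0 \<le> iter_Log j x"
  using order_trans[OF zero_le_one Log_ge_1] by (cases j) (auto simp: iter_Log_Suc)

lemma iter_Log_mono: "0 < x \<Longrightarrow> x \<le> y \<Longrightarrow> iter_Log j x \<le> iter_Log j y"
  by (induction j) (auto simp: iter_Log_Suc intro!: Log_mono iter_Log_pos)

lemma iter_Log_half: "0 < x \<Longrightarrow> iter_Log j x / 2 \<le> iter_Log j (x / 2)"
proof (induction j)
  case (Suc j)
  have "Log (iter_Log j x) / 2 \<le> Log (iter_Log j x / 2)"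
    by (intro Log_half iter_Log_pos Suc.prems)
  also have "\<dots> \<le> Log (iter_Log j (x / 2))"
    using Suc iter_Log_pos[of x j] by (intro Log_mono) auto
  finally show ?case by (simp add: iter_Log_Suc)
qed simp

text \<open>The denominator of a Bertrand series, for an arbitrary sequence of factors: it is used
  with the iterates starting at \<open>n\<close> and with those of \<open>q\<close> from the second
  one on.\<close>

definition bertrand :: "real \<Rightarrow> nat \<Rightarrow> (nat \<Rightarrow> real) \<Rightarrow> real" where
  "bertrand \<epsilon> m u = (\<Prod>j<m. u j) * u m powr (1 + \<epsilon>)"

lemma bertrand_half_le:
  assumes u: "\<And>j. 0 < u j" and v: "\<And>j. u j / 2 \<le> v j" and "0 < \<epsilon>"
  shows "bertrand \<epsilon> m u * ((1 / 2) ^ m * (1 / 2) powr (1 + \<epsilon>)) \<le> bertrand \<epsilon> m v"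
proof -
  have "(\<Prod>j<m. u j * (1 / 2)) * (u m * (1 / 2)) powr (1 + \<epsilon>) \<le> (\<Prod>j<m. v j) * v m powr (1 + \<epsilon>)"
  proof (intro mult_mono prod_mono powr_mono2 conjI)
    show "0 \<le> (\<Prod>j<m. v j)" using u v by (intro prod_nonneg) (metis half_gt_zero less_imp_le order_trans)
  qed (use u v assms(3) in \<open>auto simp: less_imp_le\<close>)
  then show ?thesis using u less_imp_le[OF u]
    by (simp add: bertrand_def prod.distrib powr_mult powr_divide mult_ac prod_dividef power_one_over)
qed

lemma bertrand_pos: "(\<And>j. 0 < u j) \<Longrightarrow> 0 < bertrand \<epsilon> m u"
  unfolding bertrand_def by (metis mult_pos_pos powr_gt_zero prod_pos less_irrefl)

lemma bertrand_nonneg: "(\<And>j. 0 \<le> u j) \<Longrightarrow> 0 \<le> bertrand \<epsilon> m u"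
  unfolding bertrand_def by (intro mult_nonneg_nonneg prod_nonneg) auto

text \<open>Cauchy condensation lowers \<open>m\<close> by one: at \<open>2 ^ i\<close> the factor
  of index 0 cancels the condensation weight, and the remaining iterates are those of
  \<open>Log (2 ^ i) \<ge> i / 2\<close>.\<close>

lemma summable_bertrand:
  assumes \<epsilon>: "0 < \<epsilon>"
  shows "summable (\<lambda>n. 1 / bertrand \<epsilon> m (\<lambda>j. iter_Log j (real n)))"
proof (induction m)
  case 0
  have "summable (\<lambda>n. real n powr (- (1 + \<epsilon>)))" using \<epsilon> by (simp add: summable_real_powr_iff)
  then have "summable (\<lambda>n. 1 / real n powr (1 + \<epsilon>))" by (simp only: powr_minus_divide)
  then show ?case by (simp add: bertrand_def)
next
  case (Suc m)
  define f where "f n = 1 / bertrand \<epsilon> (Suc m) (\<lambda>j. iter_Log j (real n))" for n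
  \<comment> \<open>The decrease starts at 1: the denominator at 0 contains the factor 0, so
    \<open>f 0\<close> is 0 by the convention for division.\<close>
  have f_mono: "f (Suc k) \<le> f k" if "0 < k" for k
    unfolding f_def
  proof (rule divide_left_mono)
    show "bertrand \<epsilon> (Suc m) (\<lambda>j. iter_Log j (real k)) \<le> bertrand \<epsilon> (Suc m) (\<lambda>j. iter_Log j (real (Suc k)))"
      unfolding bertrand_def
      using that \<epsilon> by (intro mult_mono prod_mono powr_mono2 conjI iter_Log_mono prod_nonneg)
        (auto intro!: less_imp_le[OF iter_Log_pos] prod_nonneg)
    show "0 < bertrand \<epsilon> (Suc m) (\<lambda>j. iter_Log j (real (Suc k))) * bertrand \<epsilon> (Suc m) (\<lambda>j. iter_Log j (real k))"
      using that by (intro mult_pos_pos bertrand_pos iter_Log_pos) auto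
  qed simp
  have f_nonneg: "0 \<le> f n" for n
    unfolding f_def by (intro divide_nonneg_nonneg bertrand_nonneg iter_Log_nonneg) auto
  define c where "c = (1 / 2) ^ m * (1 / 2) powr (1 + \<epsilon>)"
  have c: "0 < c" by (simp add: c_def)
  have "summable (\<lambda>i. 2 ^ i * f (2 ^ i))"
  proof (rule summable_comparison_test_ev)
    show "summable (\<lambda>n. 1 / c * (1 / bertrand \<epsilon> m (\<lambda>j. iter_Log j (real n))))"
      by (intro summable_mult Suc.IH)
    show "\<forall>\<^sub>F i in sequentially. norm (2 ^ i * f (2 ^ i)) \<le> 1 / c * (1 / bertrand \<epsilon> m (\<lambda>j. iter_Log j (real i)))"
      using eventually_gt_at_top[of 0]
    proof eventually_elim
      fix i :: nat assume i: "0 < i"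
      let ?u = "\<lambda>j. iter_Log j (real i)" and ?v = "\<lambda>j. iter_Log (Suc j) (2 ^ i)"
      have "real i * (1 / 2) \<le> real i * ln 2" using ln2_ge_two_thirds by (intro mult_left_mono) auto
      then have "real i / 2 \<le> Log (2 ^ i)" by (simp add: Log_def ln_realpow)
      then have "iter_Log j (real i / 2) \<le> ?v j" for j
        unfolding iter_Log_Suc' using i by (intro iter_Log_mono) auto
      then have v: "?u j / 2 \<le> ?v j" for j
        using iter_Log_half[of "real i" j] i by (meson of_nat_0_less_iff order_trans)
      have le: "bertrand \<epsilon> m ?u * c \<le> bertrand \<epsilon> m ?v"
        unfolding c_def using i \<epsilon> v by (intro bertrand_half_le iter_Log_pos) auto
      have eq: "bertrand \<epsilon> (Suc m) (\<lambda>j. iter_Log j (2 ^ i)) = 2 ^ i * bertrand \<epsilon> m ?v"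
        by (simp only: bertrand_def prod.lessThan_Suc_shift iter_Log_0 mult.assoc)
      have pos: "0 < bertrand \<epsilon> m ?u * c" using i c by (intro mult_pos_pos bertrand_pos iter_Log_pos) auto
      have "2 ^ i * f (2 ^ i) = 1 / bertrand \<epsilon> m ?v" unfolding f_def using eq by simp
      also have "\<dots> \<le> 1 / (bertrand \<epsilon> m ?u * c)" using le pos by (intro frac_le) auto
      finally show "norm (2 ^ i * f (2 ^ i)) \<le> 1 / c * (1 / bertrand \<epsilon> m ?u)"
        using f_nonneg[of "2 ^ i"] by (simp add: mult.commute)
    qed
  qed
  then have "summable f" using condensation_test[of f, OF f_mono f_nonneg] by blast
  then show ?case unfolding f_def .
qed

text \<open>The halves absorb \<open>ln 2\<close>. For the second bound, \<open>1 \<le> n\<close>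
  gives \<open>2 ^ n \<le> 4 ^ n / 2\<close>, so another logarithm can be taken.\<close>

lemma Log_block_ge:
  assumes "1 \<le> n" "2 ^ 4 ^ n \<le> q"
  shows "4 ^ n / 2 \<le> Log (real q)" "real n / 2 \<le> Log (Log (real q))"
proof -
  have "ln (2 ^ 4 ^ n) \<le> ln (real q)"
    using assms(2) by (intro ln_mono) (auto simp: numeral_power_le_of_nat_cancel_iff intro: less_le_trans[of 0 "2 ^ 4 ^ n"])
  then have "4 ^ n * ln 2 \<le> Log (real q)" by (simp add: Log_def ln_realpow)
  moreover have "4 ^ n * (1 / 2) \<le> 4 ^ n * ln (2::real)" using ln2_ge_two_thirds by (intro mult_left_mono) auto
  ultimately show 1: "4 ^ n / 2 \<le> Log (real q)" by linarith
  have "(2::real) ^ n * 2 \<le> 2 ^ n * 2 ^ n" using assms(1) self_le_power[of "2::real" n] by (intro mult_left_mono) auto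
  also have "\<dots> = 4 ^ n" by (simp flip: power_mult_distrib)
  finally have "2 ^ n \<le> Log (real q)" using 1 by linarith
  then have "ln (2 ^ n) \<le> ln (Log (real q))" by (intro ln_mono) auto
  then have "real n * ln 2 \<le> Log (Log (real q))" by (simp add: Log_def ln_realpow)
  moreover have "real n * (1 / 2) \<le> real n * ln 2" using ln2_ge_two_thirds by (intro mult_left_mono) auto
  ultimately show "real n / 2 \<le> Log (Log (real q))" by linarith
qed

section \<open>Checking both weights against the block criterion\<close>

theorem theorem1:
  fixes \<gamma> \<psi> :: "nat \<Rightarrow> real"
  assumes nonneg: "\<And>q. 1 \<le> q \<Longrightarrow> 0 \<le> \<psi> q"
    and decreasing: "\<And>q. 1 \<le> q \<Longrightarrow> \<psi> (q + 1) \<le> \<psi> q"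
  shows "((\<exists>\<epsilon>>0. \<exists>k\<ge>2. series_diverges (\<lambda>q. \<psi> q /
            (sqrt (Log (real q)) * (\<Prod>j=2..k-1. iter_Log j (real q))
              * iter_Log k (real q) powr (1 + \<epsilon>))))
          \<longrightarrow> measure lebesgue (W \<psi> \<gamma>) = 1)
       \<and> ((\<exists>\<epsilon>>0. series_diverges (\<lambda>q. \<psi> q * Log (real q) powr (- 1 / 2 - \<epsilon>)))
          \<longrightarrow> measure lebesgue (W \<psi> \<gamma>) = 1)"
proof (intro conjI impI)
  assume "\<exists>\<epsilon>>0. \<exists>k\<ge>2. series_diverges (\<lambda>q. \<psi> q /
            (sqrt (Log (real q)) * (\<Prod>j=2..k-1. iter_Log j (real q))
              * iter_Log k (real q) powr (1 + \<epsilon>)))"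
  then obtain \<epsilon> k where \<epsilon>: "0 < \<epsilon>" and k: "2 \<le> k" and div: "series_diverges (\<lambda>q. \<psi> q /
            (sqrt (Log (real q)) * (\<Prod>j=2..k-1. iter_Log j (real q))
              * iter_Log k (real q) powr (1 + \<epsilon>)))" by blast
  \<comment> \<open>\<open>m\<close> is the number of factors in the product over
    \<open>j=2..k-1\<close>; the empty product \<open>k = 2\<close> is \<open>m = 0\<close>.\<close>
  obtain m where m: "k = m + 2" using k le_Suc_ex by (metis add.commute)
  define v where "v q j = iter_Log (j + 2) (real q)" for q j
  define w where "w q = 1 / (sqrt (Log (real q)) * bertrand \<epsilon> m (v q))" for q
  have "(\<Prod>j=2..k-1. iter_Log j (real q)) = (\<Prod>j<m. v q j)" for q
    unfolding m v_def by (induction m) (auto simp: mult.commute)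
  then have div': "series_diverges (\<lambda>q. \<psi> q * w q)"
    using div by (simp add: w_def bertrand_def v_def m mult.assoc)
  define c where "c = (1 / 2) ^ m * (1 / 2) powr (1 + \<epsilon>)"
  have c: "0 < c" by (simp add: c_def)
  \<comment> \<open>The 2 stems from \<open>sqrt (Log q) \<ge> 2 ^ n / 2\<close>, and
    \<open>1 / c\<close> is the price of replacing the iterated logarithms of \<open>q\<close> by
    the iterates at \<open>n\<close>.\<close>
  define s where "s n = 2 / c * (1 / bertrand \<epsilon> m (\<lambda>j. iter_Log j (real n)))" for n
  have w: "w q \<le> s n / 2 ^ n" if n: "1 \<le> n" and q: "2 ^ 4 ^ n \<le> q" for n q
  proof -
    note L = Log_block_ge[OF n q]
    let ?u = "\<lambda>j. iter_Log j (real n)"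
    have u: "0 < ?u j" for j using n by (intro iter_Log_pos) auto
    have "?u j / 2 \<le> v q j" for j
    proof -
      have "?u j / 2 \<le> iter_Log j (real n / 2)" using n by (intro iter_Log_half) auto
      also have "\<dots> \<le> iter_Log j (Log (Log (real q)))" using L n by (intro iter_Log_mono) auto
      finally show ?thesis by (simp add: v_def iter_Log_Suc')
    qed
    then have b: "bertrand \<epsilon> m ?u * c \<le> bertrand \<epsilon> m (v q)"
      unfolding c_def using u \<epsilon> by (intro bertrand_half_le) auto
    have pos: "0 < bertrand \<epsilon> m ?u" using u by (rule bertrand_pos)
    have "2 ^ n / 2 \<le> sqrt (Log (real q))"
    proof (rule real_le_rsqrt)
      have "(2 ^ n / 2)\<^sup>2 = (4::real) ^ n / 4"
        by (simp add: power2_eq_square flip: power_mult_distrib)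
      also have "\<dots> \<le> 4 ^ n / 2" by simp
      finally show "(2 ^ n / 2)\<^sup>2 \<le> Log (real q)" using L by linarith
    qed
    then have "2 ^ n / 2 * (bertrand \<epsilon> m ?u * c) \<le> sqrt (Log (real q)) * bertrand \<epsilon> m (v q)"
      using b pos c Log_ge_1[of "real q"] by (intro mult_mono) auto
    then have "w q \<le> 1 / (2 ^ n / 2 * (bertrand \<epsilon> m ?u * c))"
      unfolding w_def using pos c by (intro divide_left_mono) (auto intro!: mult_pos_pos less_le_trans[OF _ b] less_le_trans[OF zero_less_one Log_ge_1])
    then show ?thesis by (simp add: s_def mult_ac)
  qed
  have "summable s" unfolding s_def by (intro summable_mult summable_bertrand \<epsilon>)
  moreover have "0 \<le> s n" for n
    unfolding s_def using c by (intro mult_nonneg_nonneg divide_nonneg_nonneg bertrand_nonneg iter_Log_nonneg) auto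
  ultimately have "\<exists>n\<ge>N. C \<le> (\<Sum>q\<in>{2 ^ 4 ^ n..<2 ^ 4 ^ Suc n}. \<psi> q) / 2 ^ n" for C N
    by (intro unbounded_blocks_of_diverges[OF _ div' w] nonneg)
  then show "measure lebesgue (W \<psi> \<gamma>) = 1"
    by (intro measure_W_of_unbounded_blocks nonneg decreasing)
next
  assume "\<exists>\<epsilon>>0. series_diverges (\<lambda>q. \<psi> q * Log (real q) powr (- 1 / 2 - \<epsilon>))"
  then obtain \<epsilon> where \<epsilon>: "0 < \<epsilon>" and div: "series_diverges (\<lambda>q. \<psi> q * Log (real q) powr (- 1 / 2 - \<epsilon>))"
    by blast
  \<comment> \<open>The exponent -1/2 yields \<open>1 / 2 ^ n\<close>, which pays for the density;
    the surplus \<open>\<epsilon>\<close> leaves the geometric series in \<open>r\<close>.\<close>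
  define r where "r = 4 powr (- \<epsilon>)"
  define c where "c = (1 / 2) powr (- 1 / 2 - \<epsilon>)"
  have r: "0 < r" "r < 1" using \<epsilon> powr_less_cancel_iff[of 4 "- \<epsilon>" 0] by (auto simp: r_def)
  have w: "Log (real q) powr (- 1 / 2 - \<epsilon>) \<le> c * r ^ n / 2 ^ n" if n: "1 \<le> n" and q: "2 ^ 4 ^ n \<le> q" for n q
  proof -
    have "Log (real q) powr (- 1 / 2 - \<epsilon>) \<le> (4 ^ n * (1 / 2)) powr (- 1 / 2 - \<epsilon>)"
      using Log_block_ge[OF n q] \<epsilon> by (intro powr_mono2') auto
    also have "\<dots> = (4 ^ n) powr (- 1 / 2 - \<epsilon>) * c" unfolding c_def by (rule powr_mult)
    also have "(4 ^ n) powr (- 1 / 2 - \<epsilon>) = (4 powr (- 1 / 2 - \<epsilon>)) ^ n"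
      by (simp add: powr_powr mult.commute flip: powr_realpow)
    also have "4 powr (- 1 / 2 - \<epsilon>) = r / 2"
    proof -
      have "4 powr (- 1 / 2 - \<epsilon>) = 4 powr (- (1 / 2)) * r" unfolding r_def by (simp flip: powr_add)
      also have "4 powr (- (1 / 2)) = 1 / (2::real)"
        by (simp only: powr_minus_divide powr_half_sqrt[of 4] real_sqrt_four) 
      finally show ?thesis by simp
    qed
    finally show ?thesis by (simp add: power_divide mult.commute)
  qed
  have "summable (\<lambda>n. c * r ^ n)" using r by (intro summable_mult summable_geometric) auto
  moreover have "0 \<le> c * r ^ n" for n using r by (simp add: c_def)
  ultimately have "\<exists>n\<ge>N. C \<le> (\<Sum>q\<in>{2 ^ 4 ^ n..<2 ^ 4 ^ Suc n}. \<psi> q) / 2 ^ n" for C N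
    by (intro unbounded_blocks_of_diverges[OF _ div w] nonneg)
  then show "measure lebesgue (W \<psi> \<gamma>) = 1"
    by (intro measure_W_of_unbounded_blocks nonneg decreasing)
qed

end
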